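(* For all $n\ge 1$ there are group isomorphisms $$\pi_1(M_n^+(SO(3)))\cong (\mathbb{Z}/2)^n,\qquad \pi_1(M_n(SU(2)))\cong 0,\qquad \pi_1(M_n(U(2)))\cong \mathbb{Z}^n .$$
   Context: For a Lie group $G$, $M_n(G)=\mathrm{Hom}(\mathbb{Z}^n,G)$ is the space of ordered commuting $n$-tuples $(A_1,\dots,A_n)$ of elements of $G$ (that is, $A_iA_j=A_jA_i$ for all $i,j$), topologized as a subspace of $G^n$. $M_n^+(SO(3))$ denotes the connected component of $M_n(SO(3))$ containing the $n$-tuple $\vec{1}=(\mathrm{id},\dots,\mathrm{id})$. The spaces $M_n(SU(2))$ and $M_n(U(2))$ are known to be connected. Here $0$ denotes the trivial group. Fundamental groups may be based at $\vec 1$. *)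

theory Defs
  imports "HOL-Analysis.Analysis" "HOL-Algebra.Product_Groups"
begin

section \<open>The fundamental group\<close>

definition loops_at :: "'a::real_normed_vector set \<Rightarrow> 'a \<Rightarrow> (real \<Rightarrow> 'a) set"
  where "loops_at S x = {p. path p \<and> path_image p \<subseteq> S \<and> pathstart p = x \<and> pathfinish p = x}"

text \<open>
  The relation \<^const>\<open>homotopic_paths\<close> fixes endpoints, so the class of a loop in \<open>S\<close> at \<open>x\<close>
  consists of loops in \<open>S\<close> at \<open>x\<close>. It only looks at the values on \<open>{0..1}\<close>, so functions that
  differ outside the unit interval are identified.
\<close>

definition homotopy_class :: "'a::real_normed_vector set \<Rightarrow> (real \<Rightarrow> 'a) \<Rightarrow> (real \<Rightarrow> 'a) set"
  where "homotopy_class S p = {q. homotopic_paths S p q}"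

definition fundamental_group :: "'a::real_normed_vector set \<Rightarrow> 'a \<Rightarrow> (real \<Rightarrow> 'a) set monoid"
  where "fundamental_group S x =
    \<lparr>carrier = homotopy_class S ` loops_at S x,
     monoid.mult = (\<lambda>X Y. \<Union>p\<in>X. \<Union>q\<in>Y. homotopy_class S (p +++ q)),
     one = homotopy_class S (linepath x x)\<rparr>"

lemma homotopy_class_eqI: "homotopic_paths S p q \<Longrightarrow> homotopy_class S p = homotopy_class S q"
  unfolding homotopy_class_def
  by (blast intro: homotopic_paths_trans homotopic_paths_trans[OF homotopic_paths_sym])

lemma homotopy_class_eq_iff:
  assumes "p \<in> loops_at S x"
  shows "homotopy_class S p = homotopy_class S q \<longleftrightarrow> homotopic_paths S p q"
proof
  assume "homotopy_class S p = homotopy_class S q"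
  moreover have "p \<in> homotopy_class S p"
    using assms by (simp add: homotopy_class_def loops_at_def)
  ultimately have "p \<in> homotopy_class S q" by simp
  then show "homotopic_paths S p q"
    by (simp add: homotopy_class_def homotopic_paths_sym)
qed (rule homotopy_class_eqI)

lemma loops_at_join: "p \<in> loops_at S x \<Longrightarrow> q \<in> loops_at S x \<Longrightarrow> p +++ q \<in> loops_at S x"
  by (simp add: loops_at_def subset_path_image_join)

lemma loops_at_linepath: "x \<in> S \<Longrightarrow> linepath x x \<in> loops_at S x"
  by (simp add: loops_at_def)

lemma loops_at_reversepath: "p \<in> loops_at S x \<Longrightarrow> reversepath p \<in> loops_at S x"
  by (simp add: loops_at_def)

lemma mult_fundamental_group:
  assumes "p \<in> loops_at S x" "q \<in> loops_at S x"
  shows "homotopy_class S p \<otimes>\<^bsub>fundamental_group S x\<^esub> homotopy_class S q = homotopy_class S (p +++ q)"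
proof -
  have "homotopy_class S (p' +++ q') = homotopy_class S (p +++ q)"
    if "p' \<in> homotopy_class S p" "q' \<in> homotopy_class S q" for p' q'
  proof -
    have "homotopic_paths S (p +++ q) (p' +++ q')"
      using that assms by (intro homotopic_paths_join) (auto simp: homotopy_class_def loops_at_def)
    then show ?thesis by (rule homotopy_class_eqI[symmetric])
  qed
  moreover have "p \<in> homotopy_class S p" "q \<in> homotopy_class S q"
    using assms by (auto simp: homotopy_class_def loops_at_def)
  ultimately have "(\<Union>p'\<in>homotopy_class S p. \<Union>q'\<in>homotopy_class S q. homotopy_class S (p' +++ q'))
      = homotopy_class S (p +++ q)"
    by blast
  then show ?thesis
    by (simp add: fundamental_group_def)
qed

lemma carrier_fundamental_group:
  "carrier (fundamental_group S x) = homotopy_class S ` loops_at S x"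
  by (simp add: fundamental_group_def)

lemma one_fundamental_group:
  "\<one>\<^bsub>fundamental_group S x\<^esub> = homotopy_class S (linepath x x)"
  by (simp add: fundamental_group_def)

theorem group_fundamental_group:
  assumes "x \<in> S"
  shows "group (fundamental_group S x)"
proof (rule groupI)
  fix X Y assume "X \<in> carrier (fundamental_group S x)" "Y \<in> carrier (fundamental_group S x)"
  then show "X \<otimes>\<^bsub>fundamental_group S x\<^esub> Y \<in> carrier (fundamental_group S x)"
    by (auto simp: carrier_fundamental_group mult_fundamental_group loops_at_join)
next
  show "\<one>\<^bsub>fundamental_group S x\<^esub> \<in> carrier (fundamental_group S x)"
    using assms by (simp add: carrier_fundamental_group one_fundamental_group loops_at_linepath)
next
  fix X Y Z
  assume "X \<in> carrier (fundamental_group S x)" "Y \<in> carrier (fundamental_group S x)"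
    "Z \<in> carrier (fundamental_group S x)"
  then obtain p q r where pqr: "p \<in> loops_at S x" "q \<in> loops_at S x" "r \<in> loops_at S x"
    and eq: "X = homotopy_class S p" "Y = homotopy_class S q" "Z = homotopy_class S r"
    by (auto simp: carrier_fundamental_group)
  have "homotopic_paths S (p +++ (q +++ r)) ((p +++ q) +++ r)"
    using pqr by (intro homotopic_paths_assoc) (auto simp: loops_at_def)
  then show "X \<otimes>\<^bsub>fundamental_group S x\<^esub> Y \<otimes>\<^bsub>fundamental_group S x\<^esub> Z
    = X \<otimes>\<^bsub>fundamental_group S x\<^esub> (Y \<otimes>\<^bsub>fundamental_group S x\<^esub> Z)"
    using pqr by (simp add: eq mult_fundamental_group loops_at_join homotopy_class_eqI)
next
  fix X assume "X \<in> carrier (fundamental_group S x)"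
  then obtain p where p: "p \<in> loops_at S x" and eq: "X = homotopy_class S p"
    by (auto simp: carrier_fundamental_group)
  have "homotopic_paths S (linepath x x +++ p) p"
    using p by (intro homotopic_paths_lid') (auto simp: loops_at_def)
  then show "\<one>\<^bsub>fundamental_group S x\<^esub> \<otimes>\<^bsub>fundamental_group S x\<^esub> X = X"
    using p assms
    by (simp add: eq one_fundamental_group mult_fundamental_group loops_at_linepath homotopy_class_eqI)
next
  fix X assume "X \<in> carrier (fundamental_group S x)"
  then obtain p where p: "p \<in> loops_at S x" and eq: "X = homotopy_class S p"
    by (auto simp: carrier_fundamental_group)
  have "homotopic_paths S (reversepath p +++ p) (linepath (pathfinish p) (pathfinish p))"
    using p by (intro homotopic_paths_linv) (auto simp: loops_at_def)
  moreover have "pathfinish p = x" using p by (simp add: loops_at_def)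
  ultimately have "homotopy_class S (reversepath p) \<otimes>\<^bsub>fundamental_group S x\<^esub> X
      = \<one>\<^bsub>fundamental_group S x\<^esub>"
    using p by (simp add: eq one_fundamental_group mult_fundamental_group loops_at_reversepath
        homotopy_class_eqI)
  moreover have "homotopy_class S (reversepath p) \<in> carrier (fundamental_group S x)"
    using p by (simp add: carrier_fundamental_group loops_at_reversepath)
  ultimately show "\<exists>Y\<in>carrier (fundamental_group S x).
      Y \<otimes>\<^bsub>fundamental_group S x\<^esub> X = \<one>\<^bsub>fundamental_group S x\<^esub>"
    by blast
qed


section \<open>The matrix groups\<close>

definition conjugate_transpose :: "complex^'m^'n \<Rightarrow> complex^'n^'m"
  where "conjugate_transpose A = map_matrix cnj (transpose A)"

definition unitary_matrix :: "complex^'n^'n \<Rightarrow> bool"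
  where "unitary_matrix A \<longleftrightarrow>
    conjugate_transpose A ** A = mat 1 \<and> A ** conjugate_transpose A = mat 1"

definition U2 :: "(complex^2^2) set"
  where "U2 = {A. unitary_matrix A}"

definition SU2 :: "(complex^2^2) set"
  where "SU2 = {A. unitary_matrix A \<and> det A = 1}"

definition SO3 :: "(real^3^3) set"
  where "SO3 = {A. rotation_matrix A}"


section \<open>Spaces of commuting tuples\<close>

text \<open>
  The finite index type \<open>'n\<close> has \<open>CARD('n)\<close> elements, an arbitrary positive number; the topology
  of the type \<open>'a^'d^'d^'n\<close> is the product topology.
\<close>

definition commuting_tuples :: "('a::real_normed_field^'d^'d) set \<Rightarrow> ('a^'d^'d^'n) set"
  where "commuting_tuples G = {A. (\<forall>i. A $ i \<in> G) \<and> (\<forall>i j. A $ i ** A $ j = A $ j ** A $ i)}"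

definition one_tuple :: "'a::real_normed_field^'d^'d^'n"
  where "one_tuple = (\<chi> i. mat 1)"

definition commuting_tuples_SO3_plus :: "(real^3^3^'n) set"
  where "commuting_tuples_SO3_plus = connected_component_set (commuting_tuples SO3) one_tuple"

lemma conjugate_transpose_mat_1 [simp]: "conjugate_transpose (mat 1) = mat 1"
  by (auto simp: conjugate_transpose_def vec_eq_iff mat_def transpose_def)

lemma one_tuple_in_commuting_tuples:
  "mat 1 \<in> G \<Longrightarrow> one_tuple \<in> commuting_tuples G"
  by (simp add: commuting_tuples_def one_tuple_def)

lemma one_tuple_in_U2: "one_tuple \<in> commuting_tuples U2"
  by (rule one_tuple_in_commuting_tuples) (simp add: U2_def unitary_matrix_def)

lemma one_tuple_in_SU2: "one_tuple \<in> commuting_tuples SU2"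
  by (rule one_tuple_in_commuting_tuples) (simp add: SU2_def unitary_matrix_def)

lemma one_tuple_in_SO3: "one_tuple \<in> commuting_tuples SO3"
  by (rule one_tuple_in_commuting_tuples)
    (simp add: SO3_def rotation_matrix_def orthogonal_matrix_id)

lemma one_tuple_in_SO3_plus: "one_tuple \<in> commuting_tuples_SO3_plus"
  by (simp add: commuting_tuples_SO3_plus_def one_tuple_in_SO3)

end

theory Submission
  imports Defs
begin

text \<open>
  All three spaces are treated through one simply connected space, the commuting tuples of unit quaternions
  (\<open>simply_connected_commuting_quaternions\<close>).

  Commuting unit quaternions have a common axis \<open>u\<close>, so such a tuple is \<open>(exp (\<theta>\<^sub>i u))\<^sub>i\<close> with \<open>u\<close> on the
  2-sphere and real angles \<open>\<theta>\<^sub>i\<close>. The set of all \<open>(u, \<theta>)\<close> is simply connected. Paths of tuples lift to it, up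
  to homotopy (\<open>paths_lift_up_to_homotopy\<close>): away from the central tuples one lifts directly, and near a central tuple
  one uses a simply connected neighbourhood. A loop at the identity therefore comes from a path that leads from
  the angles \<open>0\<close> to angles \<open>2 * pi * k\<^sub>i\<close>. At the angles \<open>pi * k\<^sub>i\<close> the tuple is central, and there the axis can be
  reversed for free; afterwards the second half of the path runs back to the angles \<open>0\<close>, and the loop is null-homotopic
  (\<open>polar_even_angles_null\<close>).

  For SU(2) this is the claim, since SU(2) is the group of unit quaternions. The other two spaces are
  quotients of simply connected spaces by free actions, and their fundamental groups are the acting groups
  (\<open>fundamental_group_orbit_map\<close>). The double covering of SO(3) by the unit quaternions maps the commuting
  quaternion tuples onto the identity component of the commuting tuples in SO(3)
  (\<open>commuting_tuples_SO3_plus_eq\<close>), with the group of sign changes acting on the fibres. Commuting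
  rotations that do not come from commuting quaternions contain two half turns about orthogonal axes; this is a closed
  condition, which separates them from the identity component. Finally, every matrix in U(2) is a scalar
  \<open>cis t\<close> times a matrix in SU(2), with \<open>t\<close> unique up to adding \<open>pi * k\<close> and changing the sign of the SU(2) factor
  accordingly. Hence the product of the commuting quaternion tuples with the space of real angles \<open>t\<^sub>i\<close> covers the
  commuting tuples in U(2), and the acting group is that of the integer tuples \<open>k\<^sub>i\<close>.
\<close>

section \<open>Orbit maps and the fundamental group\<close>

text \<open>
  A group \<open>G\<close> acts freely on \<open>C\<close> and the fibres of \<open>p\<close> are exactly the orbits, so that \<open>p ` C\<close> is the
  orbit space as a set. Two metric conditions make \<open>p\<close> a covering map. The compact set \<open>K\<close> meets every
  orbit, which forces \<open>p\<close> to be an open map although \<open>C\<close> itself may be noncompact; and nontrivial elements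
  of \<open>G\<close> move all points by at least the fixed distance \<open>e\<close>, so that small balls are embedded by \<open>p\<close>.
\<close>

locale free_orbit_map = group G for G (structure) +
  fixes C K :: "'a::real_normed_vector set"
    and p :: "'a \<Rightarrow> 'b::real_normed_vector"
    and act :: "'g \<Rightarrow> 'a \<Rightarrow> 'a"
    and e :: real
  assumes continuous_p: "continuous_on C p"
    and compact_K: "compact K" and K_subset: "K \<subseteq> C" and image_K: "p ` K = p ` C"
    and continuous_act: "g \<in> carrier G \<Longrightarrow> continuous_on C (act g)"
    and act_closed: "g \<in> carrier G \<Longrightarrow> x \<in> C \<Longrightarrow> act g x \<in> C"
    and act_one: "x \<in> C \<Longrightarrow> act \<one> x = x"
    and act_mult: "g \<in> carrier G \<Longrightarrow> h \<in> carrier G \<Longrightarrow> x \<in> C \<Longrightarrow> act (g \<otimes> h) x = act g (act h x)"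
    and p_act: "g \<in> carrier G \<Longrightarrow> x \<in> C \<Longrightarrow> p (act g x) = p x"
    and same_fibre: "x \<in> C \<Longrightarrow> y \<in> C \<Longrightarrow> p x = p y \<Longrightarrow> \<exists>g\<in>carrier G. y = act g x"
    and e_pos: "0 < e"
    and separated: "g \<in> carrier G \<Longrightarrow> g \<noteq> \<one> \<Longrightarrow> x \<in> C \<Longrightarrow> e \<le> dist (act g x) x"
begin

lemma openin_act_preimage:
  assumes "g \<in> carrier G" "openin (top_of_set C) U"
  shows "openin (top_of_set C) {x \<in> C. act g x \<in> U}"
proof -
  have "openin (top_of_set C) (C \<inter> act g -` U)"
    using continuous_openin_preimage[OF continuous_act[OF assms(1)] _ assms(2)] act_closed assms(1)
    by blast
  then show ?thesis by (simp add: vimage_def Collect_conj_eq Int_commute)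
qed

lemma act_inv_act: "g \<in> carrier G \<Longrightarrow> x \<in> C \<Longrightarrow> act (inv g) (act g x) = x"
  by (metis act_mult act_one inv_closed l_inv)

lemma close_translates_eq:
  assumes "g \<in> carrier G" "h \<in> carrier G" "x \<in> C" "dist (act g x) (act h x) < e"
  shows "g = h"
proof (rule ccontr)
  assume "g \<noteq> h"
  then have "g \<otimes> inv h \<noteq> \<one>"
    using assms inv_equality inv_inv by (metis inv_closed)
  then have "e \<le> dist (act (g \<otimes> inv h) (act h x)) (act h x)"
    using assms separated act_closed by auto
  also have "act (g \<otimes> inv h) (act h x) = act g x"
    using assms act_closed act_inv_act act_mult by auto
  finally show False using assms by simp
qed

lemma close_fibre_points_eq:
  assumes "x \<in> C" "y \<in> C" "p x = p y" "dist x y < e"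
  shows "x = y"
proof -
  obtain g where g: "g \<in> carrier G" "y = act g x"
    using same_fibre assms by blast
  have "g = \<one>"
    using close_translates_eq[of g \<one> x] assms g act_one by (simp add: dist_commute)
  then show ?thesis using g act_one assms by simp
qed

text \<open>
  Let \<open>V\<close> be the union of all translates of \<open>U\<close>; it is open and has the same image as \<open>U\<close>. Every fibre is an
  orbit and meets \<open>K\<close>, so the complement of \<open>p ` U\<close> is the image of the compact set \<open>K - V\<close>, hence closed.
\<close>

lemma open_map:
  assumes U: "openin (top_of_set C) U"
  shows "openin (top_of_set (p ` C)) (p ` U)"
proof -
  define V where "V = (\<Union>g\<in>carrier G. {x \<in> C. act g x \<in> U})"
  have UC: "U \<subseteq> C" using U openin_imp_subset by blast
  have "openin (top_of_set C) V"
    unfolding V_def using openin_act_preimage[OF _ U] by blast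
  then have "closedin (top_of_set C) (C - V)"
    by (simp add: closedin_diff)
  then obtain F where "closed F" "C - V = C \<inter> F"
    unfolding closedin_closed by blast
  then have "K \<inter> (C - V) = K \<inter> F" using K_subset by blast
  then have "compact (K \<inter> (C - V))"
    using compact_Int_closed[OF compact_K \<open>closed F\<close>] by simp
  then have "compact (p ` (K \<inter> (C - V)))"
    by (intro compact_continuous_image continuous_on_subset[OF continuous_p]) auto
  moreover have "p ` (K \<inter> (C - V)) = p ` C - p ` U"
  proof
    show "p ` (K \<inter> (C - V)) \<subseteq> p ` C - p ` U"
    proof clarify
      fix x assume x: "x \<in> K" "x \<in> C" "x \<notin> V"
      have "p x \<notin> p ` U"
      proof
        assume "p x \<in> p ` U"
        then obtain u where "u \<in> U" "p x = p u" by blast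
        then obtain g where "g \<in> carrier G" "u = act g x" using same_fibre x UC by blast
        then show False using x \<open>u \<in> U\<close> by (auto simp: V_def)
      qed
      then show "p x \<in> p ` C - p ` U" using x by blast
    qed
    show "p ` C - p ` U \<subseteq> p ` (K \<inter> (C - V))"
    proof clarify
      fix x assume x: "x \<in> C" "p x \<notin> p ` U"
      obtain k where k: "k \<in> K" "p k = p x" using image_K x by (metis imageE imageI)
      have "k \<notin> V"
        using x k p_act by (force simp: V_def image_iff)
      then show "p x \<in> p ` (K \<inter> (C - V))" using k K_subset by (metis DiffI IntI imageI subsetD)
    qed
  qed
  ultimately have "closed (p ` C - p ` U)" by (metis compact_imp_closed)
  then have "closedin (top_of_set (p ` C)) (p ` C - p ` U)"
    by (simp add: closed_subset)
  then show ?thesis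
    using UC by (metis Diff_Diff_Int image_mono inf.absorb_iff2 openin_closedin_eq topspace_euclidean_subtopology)
qed

text \<open>
  A ball of radius \<open>e / 2\<close> around a point contains at most one point of each orbit. Its preimages under the
  elements of \<open>G\<close> are therefore pairwise disjoint, and \<open>p\<close>, being open, maps each of them homeomorphically onto
  the same neighbourhood. They are the sheets over that neighbourhood.
\<close>

theorem covering_space_orbit_map: "covering_space C p (p ` C)"
proof
  fix y assume "y \<in> p ` C"
  then obtain x where x: "x \<in> C" "y = p x" by blast
  define U where "U = C \<inter> ball x (e / 2)"
  define sheet where "sheet g = {z \<in> C. act g z \<in> U}" for g
  have oU: "openin (top_of_set C) U" by (simp add: U_def openin_open_Int)
  have osheet: "openin (top_of_set C) (sheet g)" if "g \<in> carrier G" for g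
    unfolding sheet_def by (rule openin_act_preimage[OF that oU])
  have oT: "openin (top_of_set (p ` C)) (p ` U)" by (rule open_map[OF oU])
  have closeU: "dist a b < e" if "a \<in> U" "b \<in> U" for a b
    using that dist_triangle_half_r[of x a e b] by (simp add: U_def)
  have "\<Union>(sheet ` carrier G) = C \<inter> p -` (p ` U)"
  proof
    show "\<Union>(sheet ` carrier G) \<subseteq> C \<inter> p -` (p ` U)"
    proof
      fix z assume "z \<in> \<Union>(sheet ` carrier G)"
      then obtain g where "g \<in> carrier G" "z \<in> C" "act g z \<in> U" by (auto simp: sheet_def)
      then have "p z \<in> p ` U" using p_act[of g z] by (metis imageI)
      then show "z \<in> C \<inter> p -` (p ` U)" using \<open>z \<in> C\<close> by simp
    qed
    show "C \<inter> p -` (p ` U) \<subseteq> \<Union>(sheet ` carrier G)"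
    proof
      fix z assume "z \<in> C \<inter> p -` (p ` U)"
      then obtain u where "z \<in> C" "u \<in> U" "p z = p u" by blast
      then obtain g where "g \<in> carrier G" "u = act g z" using same_fibre[of z u] by (auto simp: U_def)
      then show "z \<in> \<Union>(sheet ` carrier G)" using \<open>z \<in> C\<close> \<open>u \<in> U\<close> by (auto simp: sheet_def)
    qed
  qed
  moreover have "pairwise disjnt (sheet ` carrier G)"
  proof (rule pairwiseI, clarsimp simp: disjnt_iff)
    fix g h z assume gh: "g \<in> carrier G" "h \<in> carrier G" "sheet g \<noteq> sheet h" "z \<in> sheet g" "z \<in> sheet h"
    then have "g = h"
      using close_translates_eq[of g h z] closeU[of "act g z" "act h z"] by (simp add: sheet_def)
    then show False using gh by simp
  qed
  moreover have "\<exists>q. homeomorphism (sheet g) (p ` U) p q" if g: "g \<in> carrier G" for g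
  proof (rule homeomorphism_injective_open_map)
    show "continuous_on (sheet g) p"
      by (rule continuous_on_subset[OF continuous_p]) (auto simp: sheet_def)
    show "p ` sheet g = p ` U"
    proof
      show "p ` sheet g \<subseteq> p ` U"
      proof clarify
        fix z assume "z \<in> sheet g"
        then have "z \<in> C" "act g z \<in> U" by (simp_all add: sheet_def)
        then show "p z \<in> p ` U" using p_act[OF g, of z] by (metis imageI)
      qed
      show "p ` U \<subseteq> p ` sheet g"
      proof clarify
        fix u assume u: "u \<in> U"
        then have "act g (act (inv g) u) = u"
          using act_inv_act[of "inv g" u] g by (simp add: U_def)
        then show "p u \<in> p ` sheet g"
          using u g act_closed[of "inv g" u]
          by (intro image_eqI[of _ _ "act (inv g) u"]) (auto simp: sheet_def U_def p_act)
      qed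
    qed
    show "inj_on p (sheet g)"
    proof
      fix a b assume ab: "a \<in> sheet g" "b \<in> sheet g" "p a = p b"
      have "act g a = act g b"
        using ab g closeU by (intro close_fibre_points_eq) (auto simp: sheet_def act_closed p_act)
      then show "a = b"
        using ab g by (metis (no_types, lifting) act_inv_act mem_Collect_eq sheet_def)
    qed
    fix W assume W: "openin (top_of_set (sheet g)) W"
    then have "openin (top_of_set (p ` C)) (p ` W)"
      using osheet[OF g] open_map openin_trans by blast
    moreover have "p ` W \<subseteq> p ` U"
      using W \<open>p ` sheet g = p ` U\<close> openin_imp_subset by (metis image_mono)
    ultimately show "openin (top_of_set (p ` U)) (p ` W)"
      using oT openin_imp_subset openin_subset_trans by metis
  qed blast
  ultimately show "\<exists>T. y \<in> T \<and> openin (top_of_set (p ` C)) T \<and>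
     (\<exists>v. \<Union>v = C \<inter> p -` T \<and> (\<forall>u\<in>v. openin (top_of_set C) u) \<and> pairwise disjnt v \<and>
      (\<forall>u\<in>v. \<exists>q. homeomorphism u T p q))"
    using oT x osheet e_pos
    by (intro exI[of _ "p ` U"] conjI exI[of _ "sheet ` carrier G"]) (auto simp: U_def)
qed (use continuous_p in auto)

text \<open>
  The endpoint of the lift of a loop is recorded by the element of \<open>G\<close> that carries the base point there.
\<close>

definition lifts_to :: "'a \<Rightarrow> (real \<Rightarrow> 'b) \<Rightarrow> 'g \<Rightarrow> bool"
  where "lifts_to x \<gamma> g \<longleftrightarrow> g \<in> carrier G \<and>
    (\<exists>h. path h \<and> path_image h \<subseteq> C \<and> pathstart h = x \<and> pathfinish h = act g x \<and> (\<forall>t\<in>{0..1}. p (h t) = \<gamma> t))"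

lemma lifts_toE:
  assumes "lifts_to x \<gamma> g"
  obtains h where "path h" "path_image h \<subseteq> C" "pathstart h = x" "pathfinish h = act g x"
    "\<And>t. t \<in> {0..1} \<Longrightarrow> p (h t) = \<gamma> t"
  using assms unfolding lifts_to_def by blast

lemma lifts_to_exists:
  assumes x: "x \<in> C" and \<gamma>: "\<gamma> \<in> loops_at (p ` C) (p x)"
  shows "\<exists>g. lifts_to x \<gamma> g"
proof -
  obtain h where h: "path h" "path_image h \<subseteq> C" "pathstart h = x"
    "\<And>t. t \<in> {0..1} \<Longrightarrow> p (h t) = \<gamma> t"
    using covering_space_lift_path_strong[OF covering_space_orbit_map x, of \<gamma>] \<gamma>
    by (auto simp: loops_at_def)
  have "pathfinish h \<in> C" using h by auto
  moreover have "p (pathfinish h) = p x"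
    using h(4)[of 1] \<gamma> by (simp add: pathfinish_def loops_at_def)
  ultimately obtain g where "g \<in> carrier G" "pathfinish h = act g x"
    using same_fibre[OF x] by metis
  then have "lifts_to x \<gamma> g" unfolding lifts_to_def using h by blast
  then show ?thesis by blast
qed

lemma lifts_to_unique:
  assumes x: "x \<in> C" and hom: "homotopic_paths (p ` C) \<gamma> \<gamma>'" and l: "lifts_to x \<gamma> g" "lifts_to x \<gamma>' g'"
  shows "g = g'"
proof -
  obtain h where h: "path h" "path_image h \<subseteq> C" "pathstart h = x" "pathfinish h = act g x"
    "\<And>t. t\<in>{0..1} \<Longrightarrow> p (h t) = \<gamma> t"
    using l(1) by (rule lifts_toE) blast
  obtain h' where h': "path h'" "path_image h' \<subseteq> C" "pathstart h' = x" "pathfinish h' = act g' x"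
    "\<And>t. t\<in>{0..1} \<Longrightarrow> p (h' t) = \<gamma>' t"
    using l(2) by (rule lifts_toE) blast
  have "pathfinish h = pathfinish h'"
    using hom h h' homotopic_paths_imp_path[OF hom] homotopic_paths_imp_subset[OF hom]
    by (intro covering_space_monodromy[OF covering_space_orbit_map, of \<gamma> \<gamma>' h h']) auto
  then show ?thesis
    using close_translates_eq[of g g' x] h h' l x e_pos by (simp add: lifts_to_def)
qed

text \<open>
  A lift of the second loop that starts at the end \<open>act g x\<close> of the first lift is the \<open>g\<close>-translate of the lift
  that starts at \<open>x\<close>. Hence endpoints multiply.
\<close>

lemma lifts_to_join:
  assumes x: "x \<in> C" and l: "lifts_to x \<gamma> g" "lifts_to x \<gamma>' g'"
  shows "lifts_to x (\<gamma> +++ \<gamma>') (g \<otimes> g')"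
proof -
  obtain h where h: "path h" "path_image h \<subseteq> C" "pathstart h = x" "pathfinish h = act g x"
    "\<And>t. t\<in>{0..1} \<Longrightarrow> p (h t) = \<gamma> t"
    using l(1) by (rule lifts_toE) blast
  obtain h' where h': "path h'" "path_image h' \<subseteq> C" "pathstart h' = x" "pathfinish h' = act g' x"
    "\<And>t. t\<in>{0..1} \<Longrightarrow> p (h' t) = \<gamma>' t"
    using l(2) by (rule lifts_toE) blast
  have g: "g \<in> carrier G" "g' \<in> carrier G" using l by (auto simp: lifts_to_def)
  have "path (act g \<circ> h')"
    using h' continuous_act[OF g(1)] continuous_on_subset path_continuous_image by blast
  moreover have "path_image (act g \<circ> h') \<subseteq> C"
    using h'(2) g act_closed by (auto simp: path_image_compose)
  moreover have "pathstart (act g \<circ> h') = act g x" "pathfinish (act g \<circ> h') = act (g \<otimes> g') x"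
    using h' g x by (simp_all add: pathstart_compose pathfinish_compose act_mult)
  moreover have "p ((act g \<circ> h') t) = \<gamma>' t" if "t \<in> {0..1}" for t
    using that h' g by (simp add: p_act path_image_def image_subset_iff)
  moreover have "path (h +++ (act g \<circ> h'))" "path_image (h +++ (act g \<circ> h')) \<subseteq> C"
    "pathstart (h +++ (act g \<circ> h')) = x" "pathfinish (h +++ (act g \<circ> h')) = act (g \<otimes> g') x"
    using h calculation by (simp_all add: subset_path_image_join)
  moreover have "p ((h +++ (act g \<circ> h')) t) = (\<gamma> +++ \<gamma>') t" if "t \<in> {0..1}" for t
    using that h(5)[of "2 * t"] calculation(5)[of "2 * t - 1"] by (auto simp: joinpaths_def)
  ultimately show ?thesis
    unfolding lifts_to_def using g m_closed by blast
qed

text \<open>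
  Sending a loop to the element of \<open>G\<close> that describes the endpoint of its lift is the classical isomorphism
  with the group of deck transformations. It is injective because two lifts with the same endpoints are
  homotopic in the simply connected \<open>C\<close>, and surjective because \<open>C\<close> is path connected.
\<close>

theorem fundamental_group_orbit_map:
  assumes sc: "simply_connected C" and x: "x \<in> C"
  shows "fundamental_group (p ` C) (p x) \<cong> G"
proof -
  let ?F = "fundamental_group (p ` C) (p x)"
  let ?cl = "homotopy_class (p ` C)" and ?L = "loops_at (p ` C) (p x)"
  define f where "f X = (THE g. \<exists>\<gamma>\<in>X. lifts_to x \<gamma> g)" for X
  have f: "f (?cl \<gamma>) = g" if "\<gamma> \<in> ?L" "lifts_to x \<gamma> g" for \<gamma> g
    unfolding f_def
  proof (rule the_equality)
    show "\<exists>\<gamma>'\<in>?cl \<gamma>. lifts_to x \<gamma>' g"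
      using that by (intro bexI[of _ \<gamma>]) (auto simp: homotopy_class_def loops_at_def)
    show "g' = g" if "\<exists>\<gamma>'\<in>?cl \<gamma>. lifts_to x \<gamma>' g'" for g'
      using that \<open>lifts_to x \<gamma> g\<close> lifts_to_unique[OF x] unfolding homotopy_class_def by blast
  qed
  have carr: "g \<in> carrier G" if "lifts_to x \<gamma> g" for \<gamma> g using that by (simp add: lifts_to_def)
  have "f \<in> hom ?F G"
  proof (rule homI)
    show "f X \<in> carrier G" if "X \<in> carrier ?F" for X
      using that lifts_to_exists[OF x] f carr by (fastforce simp: carrier_fundamental_group)
    fix X Y assume "X \<in> carrier ?F" "Y \<in> carrier ?F"
    then obtain a b where ab: "a \<in> ?L" "b \<in> ?L" "X = ?cl a" "Y = ?cl b"
      by (auto simp: carrier_fundamental_group)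
    obtain g h where gh: "lifts_to x a g" "lifts_to x b h"
      using lifts_to_exists[OF x] ab by blast
    show "f (X \<otimes>\<^bsub>?F\<^esub> Y) = f X \<otimes> f Y"
      using ab gh f lifts_to_join[OF x gh] by (simp add: mult_fundamental_group loops_at_join)
  qed
  moreover have "inj_on f (carrier ?F)"
  proof
    fix X Y assume "X \<in> carrier ?F" "Y \<in> carrier ?F" and eq: "f X = f Y"
    then obtain a b where ab: "a \<in> ?L" "b \<in> ?L" "X = ?cl a" "Y = ?cl b"
      by (auto simp: carrier_fundamental_group)
    obtain g where l: "lifts_to x a g" "lifts_to x b g"
      using lifts_to_exists[OF x] ab f eq by metis
    obtain h where h: "path h" "path_image h \<subseteq> C" "pathstart h = x" "pathfinish h = act g x"
      "\<And>t. t\<in>{0..1} \<Longrightarrow> p (h t) = a t"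
      using l(1) by (rule lifts_toE) blast
    obtain h' where h': "path h'" "path_image h' \<subseteq> C" "pathstart h' = x" "pathfinish h' = act g x"
      "\<And>t. t\<in>{0..1} \<Longrightarrow> p (h' t) = b t"
      using l(2) by (rule lifts_toE) blast
    have "homotopic_paths C h h'"
      using sc h h' by (auto simp: simply_connected_eq_homotopic_paths)
    then have 1: "homotopic_paths (p ` C) (p \<circ> h) (p \<circ> h')"
      by (rule homotopic_paths_continuous_image[OF _ continuous_p]) auto
    have 2: "homotopic_paths (p ` C) a (p \<circ> h)" "homotopic_paths (p ` C) b (p \<circ> h')"
      using ab h h' by (auto simp: loops_at_def intro!: homotopic_paths_eq)
    have "homotopic_paths (p ` C) a b"
      using 1 2 homotopic_paths_sym homotopic_paths_trans by blast
    then show "X = Y" using ab homotopy_class_eqI by blast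
  qed
  moreover have "f ` carrier ?F = carrier G"
  proof
    show "f ` carrier ?F \<subseteq> carrier G"
      using \<open>f \<in> hom ?F G\<close> by (auto simp: hom_def)
    show "carrier G \<subseteq> f ` carrier ?F"
    proof
      fix g assume g: "g \<in> carrier G"
      have "path_connected C" using sc simply_connected_imp_path_connected by blast
      then obtain h where h: "path h" "path_image h \<subseteq> C" "pathstart h = x" "pathfinish h = act g x"
        using x act_closed[OF g x] unfolding path_connected_def by blast
      have "lifts_to x (p \<circ> h) g" using h g by (auto simp: lifts_to_def)
      moreover have "p \<circ> h \<in> ?L"
        using h g x path_continuous_image[OF h(1) continuous_on_subset[OF continuous_p h(2)]]
        by (auto simp: loops_at_def path_image_compose pathstart_compose pathfinish_compose p_act image_mono)
      ultimately show "g \<in> f ` carrier ?F"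
        using f by (intro image_eqI[of _ _ "?cl (p \<circ> h)"]) (auto simp: carrier_fundamental_group)
    qed
  qed
  ultimately have "f \<in> iso ?F G" by (simp add: iso_def bij_betw_def)
  then show ?thesis by (rule is_isoI)
qed

end

section \<open>Commuting tuples of unit quaternions\<close>

text \<open>
  The pair \<open>(a, v)\<close> stands for the quaternion with real part \<open>a\<close> and imaginary part \<open>v\<close>.
\<close>

type_synonym quaternion = "real \<times> (real^3)"

text \<open>
  Two quaternions commute iff their imaginary parts are parallel (\<open>quaternion_mult_commute_iff\<close> below), so these
  are the commuting tuples in the group of unit quaternions.
\<close>

definition commuting_quaternions :: "(quaternion^'n) set"
  where "commuting_quaternions = {x. (\<forall>i. norm (x $ i) = 1) \<and> (\<forall>i j. cross3 (snd (x $ i)) (snd (x $ j)) = 0)}"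

text \<open>
  The tuple of exponentials \<open>exp (\<theta>\<^sub>i u)\<close>, all about the common axis \<open>u\<close>. The axis and its
  negative give the same tuples, with negated angles. If all angles are multiples of \<open>pi\<close>, the tuple is central and
  every axis gives it: over the central tuples the fibres contain whole spheres.
\<close>

definition polar :: "(real^3) \<times> (real^'n) \<Rightarrow> quaternion^'n"
  where "polar e = (\<chi> i. (cos (snd e $ i), sin (snd e $ i) *\<^sub>R fst e))"

abbreviation axis_angles :: "((real^3) \<times> (real^'n)) set"
  where "axis_angles \<equiv> sphere 0 1 \<times> UNIV"

lemma polar_nth [simp]: "polar e $ i = (cos (snd e $ i), sin (snd e $ i) *\<^sub>R fst e)"
  by (simp add: polar_def)

lemma continuous_on_polar [continuous_intros]: "continuous_on S polar"
  unfolding polar_def by (intro continuous_intros)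

lemma norm_quaternion: "norm (x :: quaternion) = 1 \<longleftrightarrow> (fst x)\<^sup>2 + (norm (snd x))\<^sup>2 = 1"
  by (cases x) (simp add: norm_Pair)

text \<open>
  By Lagrange's identity, the component of \<open>v\<close> orthogonal to \<open>u\<close> has norm zero.
\<close>

lemma parallel_to_unit:
  assumes "norm u = 1" "cross3 u v = 0"
  shows "v = (v \<bullet> u) *\<^sub>R u"
proof -
  have "(v \<bullet> u)\<^sup>2 = (norm v)\<^sup>2"
    using norm_cross_dot[of u v] assms by (simp add: inner_commute)
  then have "(norm (v - (v \<bullet> u) *\<^sub>R u))\<^sup>2 = 0"
    using assms unfolding power2_norm_eq_inner
    by (simp add: inner_diff_left inner_diff_right inner_commute power2_eq_square norm_eq_1)
  then show ?thesis by simp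
qed

lemma commuting_quaternions_sum_squares:
  "x \<in> commuting_quaternions \<Longrightarrow> (fst (x $ i))\<^sup>2 + (norm (snd (x $ i)))\<^sup>2 = 1"
  by (simp add: commuting_quaternions_def norm_quaternion)

lemma polar_in: "e \<in> axis_angles \<Longrightarrow> polar e \<in> commuting_quaternions"
  by (auto simp: commuting_quaternions_def norm_quaternion cross_mult_left cross_mult_right)

lemma polar_surjective:
  assumes x: "x \<in> commuting_quaternions"
  shows "\<exists>e \<in> axis_angles. polar e = x"
proof (cases "\<forall>i. snd (x $ i) = 0")
  case True
  have "fst (x $ i) = 1 \<or> fst (x $ i) = -1" for i
    using x True by (auto simp: commuting_quaternions_def norm_quaternion power2_eq_1_iff)
  then have "polar (axis 1 1, \<chi> i. if fst (x $ i) = 1 then 0 else pi) = x"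
    using True by (auto simp: vec_eq_iff prod_eq_iff) metis
  moreover have "(axis 1 1, \<chi> i. if fst (x $ i) = 1 then 0 else pi) \<in> axis_angles" by simp
  ultimately show ?thesis by blast
next
  case False
  then obtain i where i: "snd (x $ i) \<noteq> 0" by blast
  define u where "u = snd (x $ i) /\<^sub>R norm (snd (x $ i))"
  have u: "norm u = 1" using i by (simp add: u_def)
  have v: "snd (x $ j) = (snd (x $ j) \<bullet> u) *\<^sub>R u" for j
    using x by (intro parallel_to_unit[OF u]) (simp add: u_def cross_mult_left commuting_quaternions_def)
  have "\<exists>t. fst (x $ j) = cos t \<and> snd (x $ j) \<bullet> u = sin t" for j
  proof -
    have "(norm (snd (x $ j)))\<^sup>2 = (snd (x $ j) \<bullet> u)\<^sup>2"
      using arg_cong[OF v[of j], of norm] u by simp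
    then have "(fst (x $ j))\<^sup>2 + (snd (x $ j) \<bullet> u)\<^sup>2 = 1"
      using commuting_quaternions_sum_squares[OF x, of j] by simp
    then show ?thesis using sincos_total_2pi by metis
  qed
  then obtain \<theta> where \<theta>: "\<And>j. fst (x $ j) = cos (\<theta> j) \<and> snd (x $ j) \<bullet> u = sin (\<theta> j)" by metis
  have "polar (u, \<chi> j. \<theta> j) = x"
    using \<theta> v by (auto simp: vec_eq_iff prod_eq_iff)
  moreover have "(u, \<chi> j. \<theta> j) \<in> axis_angles" using u by simp
  ultimately show ?thesis by blast
qed

lemma image_polar: "polar ` axis_angles = commuting_quaternions"
  using polar_in polar_surjective by blast

lemma simply_connected_axis_angles: "simply_connected (axis_angles :: ((real^3) \<times> (real^'n)) set)"
  by (intro simply_connected_Times simply_connected_sphere) (auto simp: convex_imp_simply_connected)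

lemma path_connected_commuting_quaternions: "path_connected (commuting_quaternions :: (quaternion^'n) set)"
  unfolding image_polar[symmetric]
  by (intro path_connected_continuous_image continuous_intros simply_connected_imp_path_connected simply_connected_axis_angles)

lemma closed_commuting_quaternions: "closed commuting_quaternions"
  unfolding commuting_quaternions_def
  by (intro closed_Collect_conj closed_Collect_all closed_Collect_eq continuous_intros continuous_on_cross)

lemma compact_commuting_quaternions: "compact (commuting_quaternions :: (quaternion^'n) set)"
proof -
  have "norm x \<le> real CARD('n)" if "x \<in> commuting_quaternions" for x :: "quaternion^'n"
  proof -
    have "norm x \<le> (\<Sum>i\<in>UNIV. norm (x $ i))"
      unfolding norm_vec_def by (rule L2_set_le_sum) auto
    then show ?thesis using that by (simp add: commuting_quaternions_def)
  qed
  then have "bounded (commuting_quaternions :: (quaternion^'n) set)"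
    unfolding bounded_iff by blast
  then show ?thesis
    using closed_commuting_quaternions compact_eq_bounded_closed by blast
qed

section \<open>Lifting paths to axes and angles\<close>

text \<open>
  Along a path that runs into a central tuple the axis need not converge, so \<open>polar\<close> does not have the path
  lifting property. Lifting up to a homotopy with fixed endpoints is enough, and prescribing an arbitrary start
  of the lift is what allows lifts of consecutive pieces to be joined.
\<close>

definition lifts_up_to_homotopy :: "(real \<Rightarrow> quaternion^'n) \<Rightarrow> bool"
  where "lifts_up_to_homotopy g \<longleftrightarrow> (\<forall>e\<in>axis_angles. polar e = pathstart g \<longrightarrow>
    (\<exists>d. path d \<and> path_image d \<subseteq> axis_angles \<and> pathstart d = e \<and>
      homotopic_paths commuting_quaternions g (polar \<circ> d)))"

lemma lifts_up_to_homotopyE: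
  assumes "lifts_up_to_homotopy g" "e \<in> axis_angles" "polar e = pathstart g"
  obtains d where "path d" "path_image d \<subseteq> axis_angles" "pathstart d = e"
    "homotopic_paths commuting_quaternions g (polar \<circ> d)"
  using assms unfolding lifts_up_to_homotopy_def by blast

text \<open>
  While some entry \<open>i\<close> stays noncentral, the axis is plus or minus its normalised imaginary part, with a sign
  fixed by the prescribed start. Each entry then becomes a point of the unit circle of the plane spanned by \<open>1\<close>
  and the moving axis, and its angle is followed continuously by a complex logarithm. The lift is genuine.
\<close>

lemma noncentral_path_lifts:
  assumes g: "path g" "path_image g \<subseteq> commuting_quaternions"
    and i: "\<And>t. t \<in> {0..1} \<Longrightarrow> snd (g t $ i) \<noteq> 0"
  shows "lifts_up_to_homotopy g"
  unfolding lifts_up_to_homotopy_def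
proof (intro ballI impI)
  fix e assume e: "e \<in> axis_angles" "polar e = pathstart g"
  obtain u0 \<theta>0 where e_eq: "e = (u0, \<theta>0)" by fastforce
  have u0: "norm u0 = 1" using e e_eq by auto
  define v where "v t j = snd (g t $ j)" for t j
  define a where "a t j = fst (g t $ j)" for t j
  have gQ: "g t \<in> commuting_quaternions" if "t \<in> {0..1}" for t
    using g that by (auto simp: path_image_def)
  have cg: "continuous_on {0..1} g" using g by (simp add: path_def)
  have cv: "continuous_on {0..1} (\<lambda>t. v t j)" and ca: "continuous_on {0..1} (\<lambda>t. a t j)" for j
    unfolding v_def a_def by (intro continuous_intros cg)+
  have g0: "a 0 j = cos (\<theta>0 $ j)" "v 0 j = sin (\<theta>0 $ j) *\<^sub>R u0" for j
    using e unfolding a_def v_def e_eq pathstart_def by (metis polar_nth fst_conv snd_conv)+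
  \<comment> \<open>The sign that makes the axis start at \<open>u0\<close> rather than at \<open>- u0\<close>.\<close>
  define s where "s = sgn (sin (\<theta>0 $ i))"
  define U where "U t = (s / norm (v t i)) *\<^sub>R v t i" for t
  have vi: "v t i \<noteq> 0" if "t \<in> {0..1}" for t using i that by (simp add: v_def)
  have "sin (\<theta>0 $ i) \<noteq> 0" using vi[of 0] g0(2)[of i] by auto
  then have s: "\<bar>s\<bar> = 1" by (simp add: s_def sgn_real_def)
  have U0: "U 0 = u0"
    using \<open>sin (\<theta>0 $ i) \<noteq> 0\<close> by (simp add: U_def g0 u0 s_def sgn_real_def)
  have nU: "norm (U t) = 1" if "t \<in> {0..1}" for t
    using vi[OF that] s by (simp add: U_def)
  have cU: "continuous_on {0..1} U"
    unfolding U_def by (intro continuous_intros cv) (use vi in auto)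
  have vU: "v t j = (v t j \<bullet> U t) *\<^sub>R U t" if "t \<in> {0..1}" for t j
    using gQ[OF that] by (intro parallel_to_unit nU that) (simp add: U_def v_def cross_mult_left commuting_quaternions_def)
  define z where "z j t = Complex (a t j) (v t j \<bullet> U t)" for j t
  have nz: "norm (z j t) = 1" if t: "t \<in> {0..1}" for j t
  proof -
    have "(norm (v t j))\<^sup>2 = (v t j \<bullet> U t)\<^sup>2"
      using arg_cong[OF vU[OF t, of j], of norm] nU[OF t] by simp
    then show ?thesis
      using commuting_quaternions_sum_squares[OF gQ[OF t], of j] by (simp add: z_def cmod_def a_def v_def)
  qed
  have cz: "continuous_on {0..1} (z j)" for j
    unfolding z_def Complex_eq by (intro continuous_intros ca cv cU)
  have "\<exists>L. continuous_on {0..1} L \<and> (\<forall>t\<in>{0..1}. z j t = exp (L t))" for j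
  proof -
    have "contractible {0..1::real}" by (simp add: convex_imp_contractible)
    moreover have "z j t \<noteq> 0" if "t \<in> {0..1}" for t using nz[OF that, of j] by auto
    ultimately show ?thesis using continuous_logarithm_on_contractible[OF cz] by metis
  qed
  then obtain L where cL: "\<And>j. continuous_on {0..1} (L j)" and L: "\<And>j t. t \<in> {0..1} \<Longrightarrow> z j t = exp (L j t)"
    by metis
  have zcis: "z j t = cis (Im (L j t))" if "t \<in> {0..1}" for j t
  proof -
    have "exp (Re (L j t)) = 1" using nz[OF that, of j] L[OF that, of j] by (simp add: norm_exp_eq_Re)
    then show ?thesis using L[OF that, of j] by (simp add: exp_eq_polar)
  qed
  \<comment> \<open>The logarithm determines the angle up to a constant, which is shifted to match the given start.\<close>
  define \<theta> where "\<theta> j t = Im (L j t) - Im (L j 0) + \<theta>0 $ j" for j t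
  have "z j 0 = cis (\<theta>0 $ j)" for j
    using u0 by (simp add: z_def U0 g0 cis.ctr dot_square_norm)
  then have zt: "z j t = cis (\<theta> j t)" if "t \<in> {0..1}" for j t
    using zcis[OF that] zcis[of 0 j] unfolding \<theta>_def
    by (metis atLeastAtMost_iff cis_mult diff_add_cancel order_refl zero_le_one add.commute cis_divide nonzero_eq_divide_eq cis_neq_zero)
  define d where "d t = (U t, \<chi> j. \<theta> j t)" for t
  have "path d"
    unfolding path_def d_def \<theta>_def by (intro continuous_intros cU cL)
  moreover have "path_image d \<subseteq> axis_angles"
    using nU by (auto simp: path_image_def d_def)
  moreover have "pathstart d = e"
    by (simp add: pathstart_def d_def U0 \<theta>_def e_eq)
  moreover have "polar (d t) = g t" if "t \<in> {0..1}" for t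
  proof -
    have "a t j = cos (\<theta> j t)" "v t j \<bullet> U t = sin (\<theta> j t)" for j
      using zt[OF that, of j] by (auto simp: z_def complex_eq_iff)
    then show ?thesis
      using vU[OF that] by (simp add: vec_eq_iff prod_eq_iff d_def a_def v_def)
  qed
  then have "homotopic_paths commuting_quaternions g (polar \<circ> d)"
    using g by (intro homotopic_paths_eq) auto
  ultimately show "\<exists>d. path d \<and> path_image d \<subseteq> axis_angles \<and> pathstart d = e \<and>
      homotopic_paths commuting_quaternions g (polar \<circ> d)" by blast
qed

text \<open>
  For signs \<open>c i\<close>, a neighbourhood of the central tuple with real parts \<open>c i\<close> and imaginary parts zero.
\<close>

definition central_nbhd :: "('n \<Rightarrow> real) \<Rightarrow> (quaternion^'n) set"
  where "central_nbhd c = {x \<in> commuting_quaternions. \<forall>i. 0 < c i * fst (x $ i)}"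

text \<open>
  A unit quaternion in an open half sphere is determined by its imaginary part, so the neighbourhood is
  homeomorphic to a set of tuples of parallel vectors of norm less than one, which is starlike about zero.
\<close>

lemma simply_connected_central_nbhd:
  fixes c :: "'n::finite \<Rightarrow> real"
  assumes c: "\<And>i. \<bar>c i\<bar> = 1"
  shows "simply_connected (central_nbhd c)"
proof -
  define V :: "((real^3)^'n) set" where "V = {v. (\<forall>i. norm (v $ i) < 1) \<and> (\<forall>i j. cross3 (v $ i) (v $ j) = 0)}"
  define f :: "(real^3)^'n \<Rightarrow> quaternion^'n"
    where "f v = (\<chi> i. (c i * sqrt (1 - (norm (v $ i))\<^sup>2), v $ i))" for v
  define h :: "quaternion^'n \<Rightarrow> (real^3)^'n" where "h x = (\<chi> i. snd (x $ i))" for x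
  have cc: "c i * c i = 1" for i using c[of i] by (metis abs_mult_self_eq mult_1)
  have "starlike V"
    unfolding starlike_def
  proof (intro bexI[of _ 0] ballI subsetI)
    fix v w assume v: "v \<in> V" and "w \<in> closed_segment 0 v"
    then obtain r where r: "0 \<le> r" "r \<le> 1" "w = r *\<^sub>R v" by (auto simp: in_segment)
    have "norm (r *\<^sub>R v $ i) < 1" for i
      using v r mult_left_le_one_le[of "norm (v $ i)" r] by (auto simp: V_def intro: le_less_trans)
    then show "w \<in> V" using v r by (auto simp: V_def cross_mult_left cross_mult_right)
  qed (simp add: V_def)
  then have "simply_connected V" by (rule starlike_imp_simply_connected)
  moreover have "homeomorphism V (central_nbhd c) f h"
  proof
    show "continuous_on V f" "continuous_on (central_nbhd c) h"
      unfolding f_def h_def by (intro continuous_intros)+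
    have pos: "0 < 1 - (norm (v $ i))\<^sup>2" if "v \<in> V" for v i
      using that by (auto simp: V_def abs_square_less_1)
    show "f ` V \<subseteq> central_nbhd c"
    proof clarify
      fix v assume v: "v \<in> V"
      have "norm (f v $ i) = 1" for i
        using pos[OF v, of i] cc[of i] by (simp add: f_def norm_quaternion power_mult_distrib power2_eq_square[of "c i"])
      moreover have "0 < c i * fst (f v $ i)" for i
        using pos[OF v, of i] cc[of i] by (simp add: f_def mult.assoc[symmetric])
      ultimately show "f v \<in> central_nbhd c"
        using v by (auto simp: central_nbhd_def commuting_quaternions_def f_def V_def)
    qed
    have key: "norm (snd (x $ i)) < 1" "c i * sqrt (1 - (norm (snd (x $ i)))\<^sup>2) = fst (x $ i)"
      if "x \<in> central_nbhd c" for x i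
    proof -
      have 1: "(fst (x $ i))\<^sup>2 + (norm (snd (x $ i)))\<^sup>2 = 1" and 2: "0 < c i * fst (x $ i)"
        using that by (auto simp: central_nbhd_def commuting_quaternions_def norm_quaternion)
      have "0 < (fst (x $ i))\<^sup>2" using 2 by auto
      then have "(norm (snd (x $ i)))\<^sup>2 < 1" using 1 by linarith
      then show "norm (snd (x $ i)) < 1" by (simp add: abs_square_less_1)
      have "1 - (norm (snd (x $ i)))\<^sup>2 = (c i * fst (x $ i))\<^sup>2"
        using 1 cc[of i] by (simp add: power_mult_distrib power2_eq_square[of "c i"])
      then have "sqrt (1 - (norm (snd (x $ i)))\<^sup>2) = c i * fst (x $ i)"
        using 2 by simp
      then show "c i * sqrt (1 - (norm (snd (x $ i)))\<^sup>2) = fst (x $ i)"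
        using cc[of i] by (simp add: mult.assoc[symmetric])
    qed
    show "h ` central_nbhd c \<subseteq> V"
    proof clarify
      fix x assume x: "x \<in> central_nbhd c"
      show "h x \<in> V" using key(1)[OF x] x by (auto simp: V_def h_def central_nbhd_def commuting_quaternions_def)
    qed
    show "h (f v) = v" for v by (simp add: f_def h_def vec_eq_iff)
    show "f (h x) = x" if "x \<in> central_nbhd c" for x
      using key(2)[OF that] by (simp add: f_def h_def vec_eq_iff prod_eq_iff)
  qed
  ultimately show ?thesis
    using homeomorphic_simply_connected homeomorphic_def by blast
qed

text \<open>
  The number \<open>m\<close> is the multiple of \<open>pi\<close> closest to \<open>\<theta>\<close>.
\<close>

lemma angle_near_central:
  assumes c: "\<bar>c\<bar> = (1::real)" and pos: "0 < c * cos \<theta>"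
  shows "\<exists>m. \<bar>\<theta> - m\<bar> < pi / 2 \<and> cos m = c \<and> sin m = 0"
proof -
  define k where "k = round (\<theta> / pi)"
  define m where "m = of_int k * pi"
  have sm: "sin m = 0" by (simp add: m_def sin_zero_iff_int2)
  then have cm: "\<bar>cos m\<bar> = 1" using sin_zero_abs_cos_one by blast
  have cos: "cos \<theta> = cos (\<theta> - m) * cos m"
    using cos_add[of "\<theta> - m" m] sm by simp
  have "\<bar>of_int k - \<theta> / pi\<bar> \<le> 1 / 2" unfolding k_def by (rule of_int_round_abs_le)
  then have "\<bar>of_int k - \<theta> / pi\<bar> * pi \<le> 1 / 2 * pi" by (intro mult_right_mono) auto
  moreover have "\<bar>of_int k - \<theta> / pi\<bar> * pi = \<bar>\<theta> - m\<bar>"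
  proof -
    have "(of_int k - \<theta> / pi) * pi = - (\<theta> - m)" by (simp add: m_def field_simps)
    then show ?thesis by (metis abs_minus_cancel abs_mult abs_of_pos pi_gt_zero)
  qed
  ultimately have le: "\<bar>\<theta> - m\<bar> \<le> pi / 2" by simp
  have "cos \<bar>\<theta> - m\<bar> \<noteq> 0" using cos pos by auto
  then have "\<bar>\<theta> - m\<bar> \<noteq> pi / 2" using cos_pi_half by metis
  with le have lt: "\<bar>\<theta> - m\<bar> < pi / 2" by simp
  then have "0 < cos (\<theta> - m)" by (intro cos_gt_zero_pi) linarith+
  then have "0 < c * cos m" using pos unfolding cos by (metis mult.left_commute zero_less_mult_pos)
  then have "cos m = c" using c cm by (auto simp: abs_if split: if_splits)
  then show ?thesis using lt sm by blast
qed

text \<open>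
  In a simply connected neighbourhood only the endpoints of the path matter. All pairs of an axis and a tuple of
  angles less than \<open>pi / 2\<close> away from a fixed tuple of multiples of \<open>pi\<close> are mapped into the neighbourhood, and
  they form a path connected set; so any path in that set from the prescribed start to a preimage of the final
  point will do.
\<close>

lemma central_path_lifts:
  fixes g :: "real \<Rightarrow> quaternion^'n"
  assumes c: "\<And>i. \<bar>c i\<bar> = 1" and g: "path g" "path_image g \<subseteq> central_nbhd c"
  shows "lifts_up_to_homotopy g"
  unfolding lifts_up_to_homotopy_def
proof (intro ballI impI)
  fix e :: "(real^3) \<times> (real^'n)"
  assume e: "e \<in> axis_angles" "polar e = pathstart g"
  obtain e' where e': "e' \<in> axis_angles" "polar e' = pathfinish g"
    using polar_surjective[of "pathfinish g"] g pathfinish_in_path_image[of g] by (auto simp: central_nbhd_def)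
  have pos: "0 < c i * cos (snd e $ i)" "0 < c i * cos (snd e' $ i)" for i
    using g pathstart_in_path_image[of g] pathfinish_in_path_image[of g]
    unfolding e(2)[symmetric] e'(2)[symmetric] by (force simp: central_nbhd_def)+
  obtain m where m: "\<And>i. \<bar>snd e $ i - m i\<bar> < pi / 2 \<and> cos (m i) = c i \<and> sin (m i) = 0"
    using angle_near_central[OF c pos(1)] by metis
  obtain m' where m': "\<And>i. \<bar>snd e' $ i - m' i\<bar> < pi / 2 \<and> cos (m' i) = c i \<and> sin (m' i) = 0"
    using angle_near_central[OF c pos(2)] by metis
  \<comment> \<open>Near the centre \<open>m\<close> of the given start: \<open>m i - m' i\<close> is a multiple of \<open>2 * pi\<close>, so \<open>polar\<close> is unchanged.\<close>
  define e1 where "e1 = (fst e', \<chi> i. snd e' $ i - m' i + m i)"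
  have "cos (snd e1 $ i) = cos (snd e' $ i) \<and> sin (snd e1 $ i) = sin (snd e' $ i)" for i
    using cos_add[of "snd e' $ i - m' i" "m i"] cos_add[of "snd e' $ i - m' i" "m' i"]
      sin_add[of "snd e' $ i - m' i" "m i"] sin_add[of "snd e' $ i - m' i" "m' i"] m[of i] m'[of i]
    by (simp add: e1_def)
  then have pe1: "polar e1 = pathfinish g"
    unfolding e'(2)[symmetric] by (simp add: vec_eq_iff e1_def)
  define D :: "((real^3) \<times> (real^'n)) set" where "D = sphere 0 1 \<times> {\<phi>. \<forall>i. \<bar>\<phi> $ i - m i\<bar> < pi / 2}"
  have "convex {\<phi> :: real^'n. \<forall>i. \<bar>\<phi> $ i - m i\<bar> < pi / 2}"
  proof -
    have "{\<phi> :: real^'n. \<forall>i. \<bar>\<phi> $ i - m i\<bar> < pi / 2} = box (\<chi> i. m i - pi / 2) (\<chi> i. m i + pi / 2)"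
    proof -
      have "\<bar>a - b\<bar> < pi / 2 \<longleftrightarrow> b - pi / 2 < a \<and> a < b + pi / 2" for a b :: real by linarith
      then show ?thesis by (simp only: set_eq_iff mem_box_cart mem_Collect_eq vec_lambda_beta) simp
    qed
    then show ?thesis by simp
  qed
  then have "path_connected D"
    unfolding D_def by (intro path_connected_Times path_connected_sphere convex_imp_path_connected) auto
  moreover have "e \<in> D" "e1 \<in> D" using e e' m m' by (auto simp: D_def e1_def mem_Times_iff)
  ultimately obtain d where d: "path d" "path_image d \<subseteq> D" "pathstart d = e" "pathfinish d = e1"
    unfolding path_connected_def by blast
  have "polar ` D \<subseteq> central_nbhd c"
  proof clarify
    fix u \<phi> assume D: "(u, \<phi>) \<in> D"
    have "0 < c i * cos (\<phi> $ i)" for i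
    proof -
      have "0 < cos (\<phi> $ i - m i)"
      proof (rule cos_gt_zero_pi)
        have "\<bar>\<phi> $ i - m i\<bar> < pi / 2" using D by (simp add: D_def)
        then show "- (pi / 2) < \<phi> $ i - m i" "\<phi> $ i - m i < pi / 2" by linarith+
      qed
      moreover have "cos (\<phi> $ i) = cos (\<phi> $ i - m i) * c i"
        using cos_add[of "\<phi> $ i - m i" "m i"] m[of i] by simp
      ultimately show ?thesis using c[of i] by (auto simp: abs_if split: if_splits)
    qed
    moreover have "polar (u, \<phi>) \<in> commuting_quaternions" using D by (intro polar_in) (auto simp: D_def)
    ultimately show "polar (u, \<phi>) \<in> central_nbhd c" by (simp add: central_nbhd_def)
  qed
  then have "homotopic_paths (central_nbhd c) g (polar \<circ> d)"
  proof -
    have "path (polar \<circ> d)" "path_image (polar \<circ> d) \<subseteq> central_nbhd c"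
      using d \<open>polar ` D \<subseteq> central_nbhd c\<close>
      by (auto simp: path_image_compose intro!: path_continuous_image continuous_intros)
    then show ?thesis
      using simply_connected_central_nbhd[of c, OF c] g d e pe1
      by (simp add: simply_connected_eq_homotopic_paths pathstart_compose pathfinish_compose)
  qed
  then have "homotopic_paths commuting_quaternions g (polar \<circ> d)"
    by (rule homotopic_paths_subset) (auto simp: central_nbhd_def)
  then show "\<exists>d. path d \<and> path_image d \<subseteq> axis_angles \<and> pathstart d = e \<and>
      homotopic_paths commuting_quaternions g (polar \<circ> d)"
    using d by (intro exI[of _ d]) (auto simp: D_def)
qed

text \<open>
  The lifting property passes from two consecutive pieces of the path to their union, and it holds for all short
  pieces near any given time because the value there is either noncentral in some entry or central. The bisection
  principle then gives it for the whole path.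
\<close>

lemma paths_lift_up_to_homotopy:
  fixes g :: "real \<Rightarrow> quaternion^'n"
  assumes g: "path g" "path_image g \<subseteq> commuting_quaternions"
  shows "lifts_up_to_homotopy g"
proof -
  define P where "P a b \<longleftrightarrow> (0 \<le> a \<and> a \<le> b \<and> b \<le> 1 \<longrightarrow> lifts_up_to_homotopy (subpath a b g))" for a b
  have "P 0 1"
  proof (rule Bolzano[OF zero_le_one])
    fix a b c :: real assume P: "P a b" "P b c" and abc: "a \<le> b" "b \<le> c"
    show "P a c"
      unfolding P_def lifts_up_to_homotopy_def
    proof (intro impI ballI)
      fix e :: "(real^3) \<times> (real^'n)"
      assume "0 \<le> a \<and> a \<le> c \<and> c \<le> 1" and e: "e \<in> axis_angles" "polar e = pathstart (subpath a c g)"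
      then have ac: "0 \<le> a" "c \<le> 1" by auto
      have L: "lifts_up_to_homotopy (subpath a b g)"
        "lifts_up_to_homotopy (subpath b c g)"
        using P abc ac by (simp_all add: P_def)
      obtain d where d: "path d" "path_image d \<subseteq> axis_angles" "pathstart d = e"
        "homotopic_paths commuting_quaternions (subpath a b g) (polar \<circ> d)"
        by (rule lifts_up_to_homotopyE[OF L(1) e(1)]) (use e in simp)
      have fin: "pathfinish d \<in> axis_angles" using d by auto
      have finb: "polar (pathfinish d) = g b"
        using homotopic_paths_imp_pathfinish[OF d(4)] by (simp add: pathfinish_compose)
      obtain d' where d': "path d'" "path_image d' \<subseteq> axis_angles" "pathstart d' = pathfinish d"
        "homotopic_paths commuting_quaternions (subpath b c g) (polar \<circ> d')"
        by (rule lifts_up_to_homotopyE[OF L(2) fin]) (use finb in simp)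
      have "homotopic_paths commuting_quaternions (subpath a b g +++ subpath b c g) ((polar \<circ> d) +++ (polar \<circ> d'))"
        using d d' by (intro homotopic_paths_join) auto
      moreover have "homotopic_paths commuting_quaternions (subpath a b g +++ subpath b c g) (subpath a c g)"
        using abc ac by (intro homotopic_join_subpaths g) auto
      ultimately have "homotopic_paths commuting_quaternions (subpath a c g) (polar \<circ> (d +++ d'))"
        unfolding path_compose_join using homotopic_paths_sym homotopic_paths_trans by blast
      then show "\<exists>d. path d \<and> path_image d \<subseteq> axis_angles \<and> pathstart d = e \<and>
          homotopic_paths commuting_quaternions (subpath a c g) (polar \<circ> d)"
        using d d' by (intro exI[of _ "d +++ d'"]) (simp add: subset_path_image_join)
    qed
  next
    fix x :: real assume x: "0 \<le> x" "x \<le> 1"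
    have gx: "g x \<in> commuting_quaternions" using g x by (auto simp: path_image_def)
    have cg: "continuous_on {0..1} g" using g by (simp add: path_def)
    have near: "\<exists>d>0. \<forall>a b. a \<le> x \<and> x \<le> b \<and> b - a < d \<longrightarrow> P a b"
      if W: "open W" "g x \<in> W" "\<And>h. path h \<Longrightarrow> path_image h \<subseteq> commuting_quaternions \<inter> W \<Longrightarrow> lifts_up_to_homotopy h" for W
    proof -
      obtain r where r: "0 < r" "ball (g x) r \<subseteq> W" using W(1,2) open_contains_ball by blast
      obtain d where d: "d > 0" "\<And>t. t \<in> {0..1} \<Longrightarrow> dist t x < d \<Longrightarrow> dist (g t) (g x) < r"
        using cg x r unfolding continuous_on_iff by (metis atLeastAtMost_iff)
      have "P a b" if ab: "a \<le> x" "x \<le> b" "b - a < d" for a b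
        unfolding P_def
      proof
        assume 01: "0 \<le> a \<and> a \<le> b \<and> b \<le> 1"
        have "g t \<in> commuting_quaternions \<inter> W" if t: "t \<in> {a..b}" for t
        proof -
          have "dist (g t) (g x) < r"
            using t ab 01 by (intro d) (auto simp: dist_real_def)
          then have "g t \<in> W" using r by (auto simp: dist_commute)
          moreover have "g t \<in> commuting_quaternions" using g t 01 by (auto simp: path_image_def)
          ultimately show ?thesis by blast
        qed
        then have "path_image (subpath a b g) \<subseteq> commuting_quaternions \<inter> W"
          using 01 by (auto simp: path_image_subpath)
        then show "lifts_up_to_homotopy (subpath a b g)"
          using g 01 by (intro W) auto
      qed
      then show ?thesis using d by blast
    qed
    show "\<exists>d>0. \<forall>a b. a \<le> x \<and> x \<le> b \<and> b - a < d \<longrightarrow> P a b"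
    proof (cases "\<forall>i. snd (g x $ i) = 0")
      case False
      then obtain i where i: "snd (g x $ i) \<noteq> 0" by blast
      show ?thesis
      proof (rule near[of "{y. snd (y $ i) \<noteq> 0}"])
        show "open {y :: quaternion^'n. snd (y $ i) \<noteq> 0}"
          by (intro open_Collect_neq continuous_intros)
        show "lifts_up_to_homotopy h" if "path h"
          "path_image h \<subseteq> commuting_quaternions \<inter> {y. snd (y $ i) \<noteq> 0}" for h :: "real \<Rightarrow> quaternion^'n"
        proof (rule noncentral_path_lifts[of h i])
          show "snd (h t $ i) \<noteq> 0" if "t \<in> {0..1}" for t
            using that \<open>path_image h \<subseteq> _\<close> unfolding path_image_def by blast
        qed (use that in auto)
      qed (use i in simp)
    next
      case True
      define c where "c i = fst (g x $ i)" for i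
      have c: "\<bar>c i\<bar> = 1" for i
        using commuting_quaternions_sum_squares[OF gx, of i] True by (auto simp: c_def power2_eq_1_iff)
      show ?thesis
      proof (rule near[of "{y. \<forall>i. 0 < c i * fst (y $ i)}"])
        have "{y :: quaternion^'n. \<forall>i. 0 < c i * fst (y $ i)} = (\<Inter>i. {y. 0 < c i * fst (y $ i)})" by auto
        then show "open {y :: quaternion^'n. \<forall>i. 0 < c i * fst (y $ i)}"
          by (auto intro!: open_Collect_less continuous_intros open_INT)
        show "lifts_up_to_homotopy h" if "path h"
          "path_image h \<subseteq> commuting_quaternions \<inter> {y. \<forall>i. 0 < c i * fst (y $ i)}" for h :: "real \<Rightarrow> quaternion^'n"
          using that by (intro central_path_lifts[OF c]) (auto simp: central_nbhd_def)
        have "0 < c i * c i" for i using c[of i] by (metis abs_mult_self_eq mult_1 zero_less_one)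
        then show "g x \<in> {y. \<forall>i. 0 < c i * fst (y $ i)}" by (simp add: c_def)
      qed
    qed
  qed
  then show ?thesis by (simp add: P_def)
qed

section \<open>Simple connectedness\<close>

text \<open>
  Half way through the angles \<open>2 *\<^sub>R w\<close> the tuple is central, so the axis may be turned around there without
  moving the tuple. With the opposite axis, the remaining half runs back to the angle zero. The loop is thus
  homotopic to the image of a path that ends at angle zero, and such a path can be moved, within the simply
  connected set of axes and angles, to one on which all angles vanish; its image is constant.
\<close>

lemma polar_even_angles_null:
  fixes d :: "real \<Rightarrow> (real^3) \<times> (real^'n)"
  assumes d: "path d" "path_image d \<subseteq> axis_angles" "pathstart d = (u, 0)" "pathfinish d = (u', 2 *\<^sub>R w)"
    and w: "\<And>i. sin (w $ i) = 0"
  shows "homotopic_paths commuting_quaternions (polar \<circ> d) (linepath (polar (u, 0)) (polar (u, 0)))"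
proof -
  let ?E = "axis_angles :: ((real^3) \<times> (real^'n)) set"
  let ?Q = "commuting_quaternions :: (quaternion^'n) set"
  have uu: "norm u = 1" "norm u' = 1"
    using d pathstart_in_path_image[of d] pathfinish_in_path_image[of d] by auto
  have conn: "\<exists>c. path c \<and> path_image c \<subseteq> sphere 0 1 \<and> pathstart c = a \<and> pathfinish c = b"
    if "norm a = 1" "norm b = 1" for a b :: "real^3"
    using path_connected_sphere[of "0 :: real^3" 1] that unfolding path_connected_def by auto
  have E: "homotopic_paths ?Q (polar \<circ> p) (polar \<circ> q)"
    if "path p" "path q" "path_image p \<subseteq> ?E" "path_image q \<subseteq> ?E" "pathstart p = pathstart q" "pathfinish p = pathfinish q"
    for p q
  proof -
    have "homotopic_paths ?E p q"
      using simply_connected_axis_angles that unfolding simply_connected_eq_homotopic_paths by metis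
    then show ?thesis
      by (rule homotopic_paths_continuous_image) (auto intro: continuous_intros polar_in)
  qed
  obtain cA where cA: "path cA" "path_image cA \<subseteq> sphere 0 1" "pathstart cA = u" "pathfinish cA = u'"
    using conn uu by blast
  obtain cC where cC: "path cC" "path_image cC \<subseteq> sphere 0 1" "pathstart cC = u'" "pathfinish cC = - u'"
    using conn[of u' "- u'"] uu by auto
  \<comment> \<open>\<open>A\<close> reaches the central tuple, \<open>C\<close> turns the axis around, \<open>B\<close> and \<open>B'\<close> are two lifts of the second half,
    and \<open>D\<close> has the ends of \<open>A\<close>, \<open>C\<close>, \<open>B'\<close> joined but stays at angle zero.\<close>
  define A where "A t = (cA t, t *\<^sub>R w)" for t
  define B where "B t = (u', (1 + t) *\<^sub>R w)" for t
  define C where "C t = (cC t, w)" for t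
  define B' where "B' t = (- u', (1 - t) *\<^sub>R w)" for t
  define D where "D t = ((cA +++ cC) t, 0 :: real^'n)" for t
  have paths: "path A" "path B" "path C" "path B'" "path D"
  proof -
    have "path (cA +++ cC)" using cA cC by simp
    then have c: "continuous_on {0..1} cA" "continuous_on {0..1} cC" "continuous_on {0..1} (cA +++ cC)"
      using cA cC by (simp_all only: path_def)
    show "path A" "path B" "path C" "path B'" "path D"
      unfolding A_def B_def C_def B'_def D_def path_def by (intro continuous_intros c)+
  qed
  have im: "path_image A \<subseteq> ?E" "path_image B \<subseteq> ?E" "path_image C \<subseteq> ?E" "path_image B' \<subseteq> ?E" "path_image D \<subseteq> ?E"
  proof -
    have "path_image (cA +++ cC) \<subseteq> sphere 0 1"
      using cA cC by (simp add: subset_path_image_join)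
    then show "path_image A \<subseteq> ?E" "path_image B \<subseteq> ?E" "path_image C \<subseteq> ?E" "path_image B' \<subseteq> ?E" "path_image D \<subseteq> ?E"
      using cA cC uu by (auto simp: path_image_def A_def B_def C_def B'_def D_def)
  qed
  have ends: "pathstart A = (u, 0)" "pathfinish A = (u', w)" "pathstart B = (u', w)" "pathfinish B = (u', 2 *\<^sub>R w)"
    "pathstart C = (u', w)" "pathfinish C = (- u', w)" "pathstart B' = (- u', w)" "pathfinish B' = (- u', 0)"
    "pathstart D = (u, 0)" "pathfinish D = (- u', 0)"
    using cA cC by (auto simp: A_def B_def C_def B'_def D_def pathstart_def pathfinish_def joinpaths_def)
  have flip: "polar \<circ> B = polar \<circ> B'"
  proof
    fix t
    have "cos ((1 + t) * w $ i) = cos ((1 - t) * w $ i)" "sin ((1 + t) * w $ i) = - sin ((1 - t) * w $ i)" for i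
      using w[of i] by (simp_all add: distrib_right left_diff_distrib cos_add cos_diff sin_add sin_diff)
    then show "(polar \<circ> B) t = (polar \<circ> B') t"
      by (simp add: B_def B'_def vec_eq_iff)
  qed
  have const: "polar \<circ> C = linepath (polar (u', w)) (polar (u', w))" "polar \<circ> D = linepath (polar (u, 0)) (polar (u, 0))"
    using w by (auto simp: C_def D_def vec_eq_iff fun_eq_iff linepath_def)
  have img: "path (polar \<circ> p)" "path_image (polar \<circ> p) \<subseteq> ?Q" if "path p" "path_image p \<subseteq> ?E" for p
    using that by (auto intro!: path_continuous_image continuous_intros simp: path_image_compose polar_in subset_iff)
  have "homotopic_paths ?Q (polar \<circ> d) (polar \<circ> (A +++ B))"
    using d paths im ends by (intro E) (auto simp: subset_path_image_join)
  also have "polar \<circ> (A +++ B) = (polar \<circ> A) +++ (polar \<circ> B')"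
    by (simp add: path_compose_join flip)
  finally have 1: "homotopic_paths ?Q (polar \<circ> d) ((polar \<circ> A) +++ (polar \<circ> B'))" .
  have "polar (- u', w) = polar (u', w)" using w by (simp add: vec_eq_iff)
  then have "homotopic_paths ?Q ((polar \<circ> C) +++ (polar \<circ> B')) (polar \<circ> B')"
    unfolding const using img[OF paths(4) im(4)] ends
    by (intro homotopic_paths_lid') (auto simp: pathstart_compose)
  then have "homotopic_paths ?Q ((polar \<circ> A) +++ ((polar \<circ> C) +++ (polar \<circ> B'))) ((polar \<circ> A) +++ (polar \<circ> B'))"
    using img[OF paths(1) im(1)] ends
    by (intro homotopic_paths_join) (auto simp: pathstart_compose pathfinish_compose)
  then have 2: "homotopic_paths ?Q (polar \<circ> (A +++ (C +++ B'))) ((polar \<circ> A) +++ (polar \<circ> B'))"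
    by (simp add: path_compose_join)
  have 3: "homotopic_paths ?Q (polar \<circ> (A +++ (C +++ B'))) (polar \<circ> D)"
    using paths im ends by (intro E) (auto simp: subset_path_image_join)
  show ?thesis
    using 1 2 3 unfolding const by (meson homotopic_paths_sym homotopic_paths_trans)
qed

text \<open>
  A loop at the identity tuple lifts up to homotopy to a path from angles zero to angles that are multiples of
  \<open>2 * pi\<close>, so its class is trivial by \<open>polar_even_angles_null\<close>. Loops at other points are conjugate to such loops.
\<close>

theorem simply_connected_commuting_quaternions:
  "simply_connected (commuting_quaternions :: (quaternion^'n) set)"
proof -
  let ?Q = "commuting_quaternions :: (quaternion^'n) set"
  define u0 :: "real^3" where "u0 = axis 1 1"
  define b :: "quaternion^'n" where "b = polar (u0, 0)"
  have b: "b \<in> ?Q" unfolding b_def by (rule polar_in) (simp add: u0_def)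
  have null: "homotopic_paths ?Q g (linepath b b)"
    if g: "path g" "path_image g \<subseteq> ?Q" "pathstart g = b" "pathfinish g = b" for g
  proof -
    have "(u0, 0) \<in> axis_angles" by (simp add: u0_def)
    then obtain d where d: "path d" "path_image d \<subseteq> axis_angles" "pathstart d = (u0, 0)" "homotopic_paths ?Q g (polar \<circ> d)"
      using paths_lift_up_to_homotopy[OF g(1,2)] g(3) b_def unfolding lifts_up_to_homotopy_def by metis
    obtain u' \<theta> where fin: "pathfinish d = (u', \<theta>)" by fastforce
    have "polar (u', \<theta>) = b"
      using homotopic_paths_imp_pathfinish[OF d(4)] g fin by (simp add: pathfinish_compose)
    then have "cos (\<theta> $ i) = 1" for i
      unfolding b_def by (metis cos_zero fst_conv polar_nth snd_conv zero_index)
    then have "\<exists>k::int. \<theta> $ i = of_int k * 2 * pi" for i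
      using cos_one_2pi_int by auto
    then have "\<exists>k::int. (\<theta> /\<^sub>R 2) $ i = of_int k * pi" for i
      by (simp add: field_simps)
    then have "sin ((\<theta> /\<^sub>R 2) $ i) = 0" for i
      using sin_zero_iff_int2 by blast
    then have "homotopic_paths ?Q (polar \<circ> d) (linepath (polar (u0, 0)) (polar (u0, 0)))"
      using d fin by (intro polar_even_angles_null[of d u0 u' "\<theta> /\<^sub>R 2"]) auto
    then show ?thesis using d(4) homotopic_paths_trans unfolding b_def by blast
  qed
  have "homotopic_loops ?Q g (linepath b b)"
    if g: "path g" "path_image g \<subseteq> ?Q" "pathfinish g = pathstart g" for g
  proof -
    have "pathstart g \<in> ?Q" using g by auto
    then obtain r where r: "path r" "path_image r \<subseteq> ?Q" "pathstart r = b" "pathfinish r = pathstart g"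
      using path_connected_commuting_quaternions b unfolding path_connected_def by metis
    have "homotopic_paths ?Q (r +++ g +++ reversepath r) (linepath b b)"
      using r g by (intro null) (simp_all add: subset_path_image_join)
    then have "homotopic_loops ?Q (r +++ g +++ reversepath r) (linepath b b)"
      using r g by (intro homotopic_paths_imp_homotopic_loops) auto
    moreover have "homotopic_loops ?Q (r +++ g +++ reversepath r) g"
      using r g by (intro homotopic_loops_conjugate) auto
    ultimately show ?thesis using homotopic_loops_sym homotopic_loops_trans by blast
  qed
  then show ?thesis
    unfolding simply_connected_eq_contractible_loop_all using b by blast
qed

section \<open>Tuples in SU(2)\<close>

definition quaternion_mult :: "quaternion \<Rightarrow> quaternion \<Rightarrow> quaternion"
  where "quaternion_mult x y = (fst x * fst y - snd x \<bullet> snd y,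
    fst x *\<^sub>R snd y + fst y *\<^sub>R snd x + cross3 (snd x) (snd y))"

lemma quaternion_mult_commute_iff:
  "quaternion_mult x y = quaternion_mult y x \<longleftrightarrow> cross3 (snd x) (snd y) = 0"
proof
  assume "quaternion_mult x y = quaternion_mult y x"
  then have "cross3 (snd x) (snd y) = cross3 (snd y) (snd x)"
    by (simp add: quaternion_mult_def inner_commute add.commute)
  then have "cross3 (snd x) (snd y) = - cross3 (snd x) (snd y)" using cross_skew by metis
  then have "2 *\<^sub>R cross3 (snd x) (snd y) = 0" unfolding scaleR_2 by (metis add.right_inverse)
  then show "cross3 (snd x) (snd y) = 0" by simp
next
  assume "cross3 (snd x) (snd y) = 0"
  moreover have "cross3 (snd y) (snd x) = 0" using calculation cross_skew[of "snd y" "snd x"] by simp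
  ultimately show "quaternion_mult x y = quaternion_mult y x"
    by (simp add: quaternion_mult_def inner_commute add.commute)
qed

lemma norm_quaternion_components:
  "norm (x :: quaternion) = 1 \<longleftrightarrow> (fst x)\<^sup>2 + (snd x $ 1)\<^sup>2 + (snd x $ 2)\<^sup>2 + (snd x $ 3)\<^sup>2 = 1"
  unfolding norm_quaternion power2_norm_eq_inner
  by (simp add: inner_vec_def sum_3 power2_eq_square add.assoc)

lemma norm_quaternion_mult:
  assumes "norm x = 1" "norm y = 1"
  shows "norm (quaternion_mult x y) = 1"
proof -
  let ?N = "\<lambda>z :: quaternion. (fst z)\<^sup>2 + (snd z $ 1)\<^sup>2 + (snd z $ 2)\<^sup>2 + (snd z $ 3)\<^sup>2"
  have "?N (quaternion_mult x y) = ?N x * ?N y"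
    by (simp add: quaternion_mult_def cross_components inner_vec_def sum_3 power2_eq_square algebra_simps)
  then show ?thesis using assms unfolding norm_quaternion_components by simp
qed

text \<open>
  The standard embedding of the quaternions in the complex matrices of size two, with \<open>i\<close>, \<open>j\<close>, \<open>k\<close> mapped
  to \<open>((\<i>, 0), (0, -\<i>))\<close>, \<open>((0, 1), (-1, 0))\<close> and \<open>((0, \<i>), (\<i>, 0))\<close>.
\<close>

definition quaternion_matrix :: "quaternion \<Rightarrow> complex^2^2"
  where "quaternion_matrix x = vector
    [vector [Complex (fst x) (snd x $ 1), Complex (snd x $ 2) (snd x $ 3)],
     vector [Complex (- (snd x $ 2)) (snd x $ 3), Complex (fst x) (- (snd x $ 1))]]"

lemma quaternion_matrix_nth [simp]:
  "quaternion_matrix x $ 1 $ 1 = Complex (fst x) (snd x $ 1)"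
  "quaternion_matrix x $ 1 $ 2 = Complex (snd x $ 2) (snd x $ 3)"
  "quaternion_matrix x $ 2 $ 1 = Complex (- (snd x $ 2)) (snd x $ 3)"
  "quaternion_matrix x $ 2 $ 2 = Complex (fst x) (- (snd x $ 1))"
  by (simp_all add: quaternion_matrix_def)

lemma quaternion_matrix_mult:
  "quaternion_matrix x ** quaternion_matrix y = quaternion_matrix (quaternion_mult x y)"
  by (simp add: vec_eq_iff forall_2 matrix_matrix_mult_def sum_2 complex_eq_iff quaternion_mult_def
      cross_components inner_vec_def sum_3 algebra_simps)

lemma quaternion_matrix_eq_iff [simp]: "quaternion_matrix x = quaternion_matrix y \<longleftrightarrow> x = y"
  by (auto simp: vec_eq_iff forall_2 forall_3 complex_eq_iff prod_eq_iff)

lemma quaternion_matrix_commute_iff: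
  "quaternion_matrix x ** quaternion_matrix y = quaternion_matrix y ** quaternion_matrix x
    \<longleftrightarrow> cross3 (snd x) (snd y) = 0"
  by (simp add: quaternion_matrix_mult quaternion_mult_commute_iff)

lemma continuous_on_matrixI:
  fixes F :: "'a::topological_space \<Rightarrow> 'b::topological_space^'n^'m"
  assumes "\<And>i j. continuous_on S (\<lambda>x. F x $ i $ j)"
  shows "continuous_on S F"
proof -
  have "continuous_on S (\<lambda>x. \<chi> i j. F x $ i $ j)"
    by (intro continuous_on_vec_lambda assms)
  then show ?thesis by simp
qed

lemma continuous_on_quaternion_matrix [continuous_intros]:
  assumes f: "continuous_on S f"
  shows "continuous_on S (\<lambda>x. quaternion_matrix (f x))"
proof (rule continuous_on_matrixI)
  fix i j :: 2
  consider "i = 1" "j = 1" | "i = 1" "j = 2" | "i = 2" "j = 1" | "i = 2" "j = 2"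
    using exhaust_2 by metis
  then show "continuous_on S (\<lambda>x. quaternion_matrix (f x) $ i $ j)"
    by cases (simp_all add: Complex_eq, (intro continuous_intros f)+)
qed

lemma conjugate_transpose_quaternion_matrix:
  "conjugate_transpose (quaternion_matrix x) = quaternion_matrix (fst x, - snd x)"
  by (simp add: vec_eq_iff forall_2 conjugate_transpose_def transpose_def complex_eq_iff map_matrix_def)

lemma quaternion_matrix_one: "quaternion_matrix (1, 0) = mat 1"
  by (simp add: vec_eq_iff forall_2 mat_def complex_eq_iff)

lemma det_quaternion_matrix: "norm x = 1 \<Longrightarrow> det (quaternion_matrix x) = 1"
  unfolding norm_quaternion_components
  by (simp add: det_2 complex_eq_iff power2_eq_square algebra_simps)

lemma quaternion_mult_conjugate:
  assumes "norm x = 1"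
  shows "quaternion_mult (fst x, - snd x) x = (1, 0)" "quaternion_mult x (fst x, - snd x) = (1, 0)"
  using assms unfolding norm_quaternion power2_norm_eq_inner
  by (simp_all add: quaternion_mult_def power2_eq_square)

lemma quaternion_matrix_in_SU2:
  assumes "norm x = 1"
  shows "quaternion_matrix x \<in> SU2"
  using assms quaternion_mult_conjugate[OF assms]
  by (simp add: SU2_def unitary_matrix_def conjugate_transpose_quaternion_matrix
    quaternion_matrix_mult quaternion_matrix_one det_quaternion_matrix)

text \<open>
  The conjugate transpose of \<open>A\<close> is its inverse, which is the adjugate \<open>B\<close> because the determinant is one.
  Comparing entries shows that \<open>A\<close> has the form of a quaternion matrix.
\<close>

lemma SU2_eq_quaternion_matrix:
  assumes "A \<in> SU2"
  shows "\<exists>x. norm x = 1 \<and> A = quaternion_matrix x"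
proof -
  have u: "conjugate_transpose A ** A = mat 1" and d: "det A = 1"
    using assms by (auto simp: SU2_def unitary_matrix_def)
  define B :: "complex^2^2" where "B = vector [vector [A $ 2 $ 2, - (A $ 1 $ 2)], vector [- (A $ 2 $ 1), A $ 1 $ 1]]"
  have "A ** B = mat 1"
    using d by (simp add: B_def vec_eq_iff forall_2 matrix_matrix_mult_def sum_2 mat_def det_2 algebra_simps)
  then have "conjugate_transpose A = B"
    using u by (metis matrix_mul_assoc matrix_mul_lid matrix_mul_rid)
  then have "cnj (A $ 1 $ 1) = A $ 2 $ 2" "cnj (A $ 2 $ 1) = - (A $ 1 $ 2)"
    by (auto simp: vec_eq_iff forall_2 conjugate_transpose_def transpose_def map_matrix_def B_def)
  moreover define x :: quaternion where
    "x = (Re (A $ 1 $ 1), vector [Im (A $ 1 $ 1), Re (A $ 1 $ 2), Im (A $ 1 $ 2)])"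
  ultimately have A: "A = quaternion_matrix x"
    by (auto simp: vec_eq_iff forall_2 complex_eq_iff)
  have "norm x = 1"
    using d unfolding A norm_quaternion_components
    by (simp add: det_2 complex_eq_iff power2_eq_square algebra_simps)
  then show ?thesis using A by blast
qed

text \<open>
  Entrywise, SU(2) is the group of unit quaternions, and commutation is the same condition on both sides.
\<close>

lemma commuting_tuples_SU2_eq:
  "commuting_tuples SU2 = (\<lambda>x. \<chi> i. quaternion_matrix (x $ i)) ` (commuting_quaternions :: (quaternion^'n) set)"
proof
  show "(\<lambda>x. \<chi> i. quaternion_matrix (x $ i)) ` commuting_quaternions \<subseteq> commuting_tuples SU2"
    by (auto simp: commuting_tuples_def commuting_quaternions_def quaternion_matrix_in_SU2
      quaternion_matrix_commute_iff)
  show "commuting_tuples SU2 \<subseteq> (\<lambda>x. \<chi> i. quaternion_matrix (x $ i)) ` (commuting_quaternions :: (quaternion^'n) set)"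
  proof
    fix A :: "complex^2^2^'n" assume A: "A \<in> commuting_tuples SU2"
    then have "\<exists>x. norm x = 1 \<and> A $ i = quaternion_matrix x" for i
      by (intro SU2_eq_quaternion_matrix) (simp add: commuting_tuples_def)
    then obtain x where x: "\<And>i. norm (x i) = 1 \<and> A $ i = quaternion_matrix (x i)" by metis
    have "A $ i ** A $ j = A $ j ** A $ i" for i j
      using A by (simp add: commuting_tuples_def)
    then have "cross3 (snd (x i)) (snd (x j)) = 0" for i j
      using x by (simp add: quaternion_matrix_commute_iff)
    then have "(\<chi> i. x i) \<in> commuting_quaternions"
      using x by (simp add: commuting_quaternions_def)
    moreover have "A = (\<lambda>x. \<chi> i. quaternion_matrix (x $ i)) (\<chi> i. x i)"
      using x by (simp add: vec_eq_iff)
    ultimately show "A \<in> (\<lambda>x. \<chi> i. quaternion_matrix (x $ i)) ` commuting_quaternions" by blast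
  qed
qed

lemma simply_connected_commuting_tuples_SU2: "simply_connected (commuting_tuples SU2 :: (complex^2^2^'n) set)"
proof -
  have "(commuting_quaternions :: (quaternion^'n) set) homeomorphic (commuting_tuples SU2 :: (complex^2^2^'n) set)"
    unfolding commuting_tuples_SU2_eq
    by (rule homeomorphic_compact[OF compact_commuting_quaternions _ refl])
      (auto intro!: continuous_intros inj_onI simp: vec_eq_iff[where 'b='n])
  then show ?thesis
    using homeomorphic_simply_connected simply_connected_commuting_quaternions by blast
qed

lemma fundamental_group_simply_connected:
  assumes "simply_connected S" "x \<in> S"
  shows "fundamental_group S x \<cong> singleton_group z"
proof -
  have "homotopy_class S p = homotopy_class S (linepath x x)" if "p \<in> loops_at S x" for p
    using that assms(1) by (intro homotopy_class_eqI) (auto simp: simply_connected_eq_contractible_path loops_at_def)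
  then have c: "carrier (fundamental_group S x) = {homotopy_class S (linepath x x)}"
    using loops_at_linepath[OF assms(2)] unfolding carrier_fundamental_group by blast
  have "(\<lambda>_. z) \<in> iso (fundamental_group S x) (singleton_group z)"
    unfolding iso_def hom_def bij_betw_def c by (simp add: singleton_group_def)
  then show ?thesis by (rule is_isoI)
qed

section \<open>Sign changes of quaternion tuples\<close>

text \<open>
  The nontrivial character of \<open>\<int>/2\<close>, pulled back to the integers. It lets one action of integer tuples serve both
  the covering of the tuples in U(2), with integer exponents, and that of the tuples in SO(3), with exponents
  zero and one.
\<close>

definition parity_sign :: "int \<Rightarrow> real"
  where "parity_sign k = (if even k then 1 else -1)"

lemma parity_sign_add: "parity_sign (j + k) = parity_sign j * parity_sign k"
  by (simp add: parity_sign_def)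

lemma cis_int_pi: "cis (pi * of_int k) = of_real (parity_sign k)"
  by (simp add: complex_eq_iff parity_sign_def)

definition sign_change :: "('n \<Rightarrow> int) \<Rightarrow> quaternion^'n \<Rightarrow> quaternion^'n"
  where "sign_change g x = (\<chi> i. parity_sign (g i) *\<^sub>R x $ i)"

lemma sign_change_in:
  "x \<in> commuting_quaternions \<Longrightarrow> sign_change g x \<in> commuting_quaternions"
  by (auto simp: sign_change_def commuting_quaternions_def parity_sign_def)

lemma continuous_on_sign_change [continuous_intros]:
  "continuous_on S f \<Longrightarrow> continuous_on S (\<lambda>x. sign_change g (f x))"
  unfolding sign_change_def by (intro continuous_intros)

lemma dist_sign_change:
  assumes "x \<in> commuting_quaternions" "odd (g i)"
  shows "2 \<le> dist (sign_change g x) x"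
proof -
  have "x $ i - sign_change g x $ i = 2 *\<^sub>R x $ i"
    using assms by (simp add: sign_change_def parity_sign_def scaleR_2)
  then have "2 = dist (sign_change g x $ i) (x $ i)"
    using assms by (simp add: dist_norm norm_minus_commute commuting_quaternions_def)
  also have "\<dots> \<le> dist (sign_change g x) x" by (rule dist_vec_nth_le)
  finally show ?thesis .
qed

section \<open>Tuples in U(2)\<close>

lemma mat_matrix_mult: "mat c ** A = (\<chi> i j. c * A $ i $ j)" for A :: "'a::semiring_1^'n^'m"
proof -
  have "(\<Sum>k\<in>UNIV. (if i = k then c else 0) * A $ k $ j) = (\<Sum>k\<in>UNIV. if i = k then c * A $ k $ j else 0)" for i j
    by (rule sum.cong) auto
  then show ?thesis
    by (simp add: matrix_matrix_mult_def mat_def vec_eq_iff)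
qed

lemma mat_mult_mult: "(mat a ** A) ** (mat b ** B) = mat (a * b) ** (A ** B)"
  for A :: "'a::comm_semiring_1^'n^'m" and B :: "'a^'k^'n"
  unfolding mat_matrix_mult by (simp add: matrix_matrix_mult_def vec_eq_iff sum_distrib_left mult_ac)

lemma mat_cis_cancel: "mat (cis t) ** (mat (cis (- t)) ** A) = A" "mat (cis (- t)) ** (mat (cis t) ** A) = A"
  for A :: "complex^'n^'m"
  by (simp_all add: mat_matrix_mult vec_eq_iff mult.assoc[symmetric] cis_mult)

lemma mat_cis_mult_cancel_iff: "mat (cis t) ** A = mat (cis t) ** B \<longleftrightarrow> A = B"
  for A B :: "complex^'n^'m"
  by (metis mat_cis_cancel(2))

lemma conjugate_transpose_mat_mult:
  "conjugate_transpose (mat c ** A) = mat (cnj c) ** conjugate_transpose A"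
  by (simp add: mat_matrix_mult conjugate_transpose_def transpose_def map_matrix_def vec_eq_iff)

lemma unitary_matrix_mat_cis_mult:
  assumes "unitary_matrix A"
  shows "unitary_matrix (mat (cis t) ** A)"
  using assms
  by (simp add: unitary_matrix_def conjugate_transpose_mat_mult mat_mult_mult cis_cnj cis_mult)

lemma det_mat_cis_mult: "det (mat (cis t) ** A) = cis (2 * t) * det A" for A :: "complex^2^2"
proof -
  have "cis (2 * t) = cis t * cis t" by (simp add: cis_mult)
  then show ?thesis by (simp add: mat_matrix_mult det_2 algebra_simps)
qed

text \<open>
  The scalar factor is a square root of the determinant; half of an argument in \<open>[0, 2 * pi)\<close> lies in \<open>[0, pi]\<close>.
\<close>

lemma U2_decomposition:
  assumes "A \<in> U2"
  shows "\<exists>x t. norm x = 1 \<and> 0 \<le> t \<and> t \<le> pi \<and> A = mat (cis t) ** quaternion_matrix x"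
proof -
  have A: "unitary_matrix A" using assms by (simp add: U2_def)
  have "det (conjugate_transpose A) = cnj (det A)"
    by (simp add: conjugate_transpose_def transpose_def map_matrix_def det_2)
  then have "cnj (det A) * det A = det (conjugate_transpose A ** A)"
    by (simp add: det_mul)
  also have "\<dots> = 1" using A by (simp add: unitary_matrix_def)
  finally have "(Re (det A))\<^sup>2 + (Im (det A))\<^sup>2 = 1"
    by (simp add: complex_eq_iff power2_eq_square)
  then obtain s where s: "0 \<le> s" "s < 2 * pi" "Re (det A) = cos s" "Im (det A) = sin s"
    using sincos_total_2pi by metis
  then have d: "det A = cis s" by (simp add: complex_eq_iff)
  have "mat (cis (- (s / 2))) ** A \<in> SU2"
    using unitary_matrix_mat_cis_mult[OF A] by (simp add: SU2_def det_mat_cis_mult d cis_mult)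
  then obtain x where "norm x = 1" "mat (cis (- (s / 2))) ** A = quaternion_matrix x"
    using SU2_eq_quaternion_matrix by blast
  moreover have "A = mat (cis (s / 2)) ** quaternion_matrix x"
    using calculation(2) mat_cis_cancel(1)[of "s / 2" A] by simp
  moreover have "0 \<le> s / 2" "s / 2 \<le> pi" using s by auto
  ultimately show ?thesis by blast
qed

text \<open>
  The determinants give \<open>cis (2 * s) = cis (2 * t)\<close>, so the angles differ by \<open>pi * k\<close> and the scalar factors by the
  sign of \<open>k\<close>, which the quaternions have to compensate.
\<close>

lemma U2_decomposition_unique:
  assumes "norm x = 1" "norm y = 1"
    and eq: "mat (cis s) ** quaternion_matrix x = mat (cis t) ** quaternion_matrix y"
  shows "\<exists>k::int. t = s + pi * of_int k \<and> y = parity_sign k *\<^sub>R x"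
proof -
  have "cis (2 * s) = cis (2 * t)"
    using arg_cong[OF eq, of det] assms(1,2) by (simp add: det_mat_cis_mult det_quaternion_matrix)
  then have "sin (2 * t) = sin (2 * s) \<and> cos (2 * t) = cos (2 * s)" by (simp add: complex_eq_iff)
  then obtain k :: int where "2 * t = 2 * s + 2 * pi * of_int k"
    using sin_cos_eq_iff by blast
  then have t: "t = s + pi * of_int k" by simp
  have "cis t = cis s * of_real (parity_sign k)"
    unfolding t by (metis cis_mult cis_int_pi)
  then have "mat (cis t) ** quaternion_matrix y = mat (cis s) ** quaternion_matrix (parity_sign k *\<^sub>R y)"
    by (auto simp: mat_matrix_mult vec_eq_iff forall_2 complex_eq_iff parity_sign_def)
  then have "x = parity_sign k *\<^sub>R y"
    using eq by (simp add: mat_cis_mult_cancel_iff)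
  then have "y = parity_sign k *\<^sub>R x" by (simp add: parity_sign_def)
  then show ?thesis using t by blast
qed

text \<open>
  The second component lists the angles of the scalar factors. Using real angles instead of points on the circle
  makes the domain simply connected, so that this becomes the universal covering.
\<close>

definition U2_cover :: "(quaternion^'n) \<times> (real^'n) \<Rightarrow> complex^2^2^'n"
  where "U2_cover z = (\<chi> i. mat (cis (snd z $ i)) ** quaternion_matrix (fst z $ i))"

text \<open>
  Scalars are central, so they do not affect commutation. The statement covers both the full domain of the
  covering and its compact part that meets every orbit.
\<close>

lemma commuting_tuples_U2_eq:
  fixes K :: "((quaternion^'n) \<times> (real^'n)) set"
  assumes K: "commuting_quaternions \<times> {\<theta>. \<forall>i. 0 \<le> \<theta> $ i \<and> \<theta> $ i \<le> pi} \<subseteq> K" "K \<subseteq> commuting_quaternions \<times> UNIV"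
  shows "U2_cover ` K = commuting_tuples U2"
proof
  show "U2_cover ` K \<subseteq> commuting_tuples U2"
  proof
    fix A assume "A \<in> U2_cover ` K"
    then obtain x s where x: "x \<in> commuting_quaternions" and A: "A = U2_cover (x, s)" using K by auto
    have "A $ i \<in> U2" for i
    proof -
      have "quaternion_matrix (x $ i) \<in> SU2"
        using x by (intro quaternion_matrix_in_SU2) (simp add: commuting_quaternions_def)
      then show ?thesis by (simp add: A U2_cover_def U2_def SU2_def unitary_matrix_mat_cis_mult)
    qed
    moreover have "A $ i ** A $ j = A $ j ** A $ i" for i j
    proof -
      have "quaternion_matrix (x $ i) ** quaternion_matrix (x $ j) = quaternion_matrix (x $ j) ** quaternion_matrix (x $ i)"
        using x by (simp add: quaternion_matrix_commute_iff commuting_quaternions_def)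
      then show ?thesis by (simp add: A U2_cover_def mat_mult_mult mult.commute)
    qed
    ultimately show "A \<in> commuting_tuples U2" by (simp add: commuting_tuples_def)
  qed
  show "commuting_tuples U2 \<subseteq> U2_cover ` K"
  proof
    fix A :: "complex^2^2^'n" assume A: "A \<in> commuting_tuples U2"
    then have "\<exists>x t. norm x = 1 \<and> 0 \<le> t \<and> t \<le> pi \<and> A $ i = mat (cis t) ** quaternion_matrix x" for i
      by (intro U2_decomposition) (simp add: commuting_tuples_def)
    then obtain x t where x: "\<And>i. norm (x i) = 1 \<and> 0 \<le> t i \<and> t i \<le> pi \<and> A $ i = mat (cis (t i)) ** quaternion_matrix (x i)"
      by metis
    have "cross3 (snd (x i)) (snd (x j)) = 0" for i j
    proof -
      have "A $ i ** A $ j = A $ j ** A $ i" using A by (simp add: commuting_tuples_def)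
      then have "mat (cis (t i + t j)) ** (quaternion_matrix (x i) ** quaternion_matrix (x j))
          = mat (cis (t i + t j)) ** (quaternion_matrix (x j) ** quaternion_matrix (x i))"
        using x by (simp add: mat_mult_mult cis_mult add.commute)
      then show ?thesis by (simp add: mat_cis_mult_cancel_iff quaternion_matrix_commute_iff)
    qed
    then have "(\<chi> i. x i) \<in> commuting_quaternions"
      using x by (simp add: commuting_quaternions_def)
    then have "(\<chi> i. x i, \<chi> i. t i) \<in> K" using x by (intro subsetD[OF K(1)]) simp
    moreover have "A = U2_cover (\<chi> i. x i, \<chi> i. t i)"
      using x by (simp add: vec_eq_iff U2_cover_def)
    ultimately show "A \<in> U2_cover ` K" by blast
  qed
qed

text \<open>
  An integer tuple \<open>g\<close> acts by adding \<open>pi * g i\<close> to the angles and multiplying the quaternions by the signs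
  \<open>(-1)^(g i)\<close>; by \<open>U2_decomposition_unique\<close> the orbits are the fibres of \<open>U2_cover\<close>. A nontrivial element changes
  some angle by at least \<open>pi\<close>.
\<close>

lemma fundamental_group_commuting_tuples_U2:
  "fundamental_group (commuting_tuples U2 :: (complex^2^2^'n) set) one_tuple
    \<cong> product_group (UNIV :: 'n set) (\<lambda>_. integer_group)"
proof -
  let ?G = "product_group (UNIV :: 'n set) (\<lambda>_. integer_group)"
  let ?Q = "commuting_quaternions :: (quaternion^'n) set"
  let ?K = "?Q \<times> {\<theta> :: real^'n. \<forall>i. 0 \<le> \<theta> $ i \<and> \<theta> $ i \<le> pi}"
  define act :: "('n \<Rightarrow> int) \<Rightarrow> (quaternion^'n) \<times> (real^'n) \<Rightarrow> (quaternion^'n) \<times> (real^'n)"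
    where "act g z = (sign_change g (fst z), snd z + (\<chi> i. pi * of_int (g i)))" for g z
  have im: "U2_cover ` ?K = commuting_tuples U2" "U2_cover ` (?Q \<times> UNIV) = commuting_tuples U2"
    by (rule commuting_tuples_U2_eq; blast)+
  have carrier: "carrier ?G = UNIV" and one: "\<one>\<^bsub>?G\<^esub> = (\<lambda>_. 0)"
    and mult: "g \<otimes>\<^bsub>?G\<^esub> h = (\<lambda>i. g i + h i)" for g h
    by (simp_all add: PiE_UNIV_domain integer_group_def restrict_def)
  have compact_K: "compact ?K"
  proof (intro compact_Times compact_commuting_quaternions)
    have "{\<theta> :: real^'n. \<forall>i. 0 \<le> \<theta> $ i \<and> \<theta> $ i \<le> pi} = cbox 0 (\<chi> i. pi)"
      by (auto simp: mem_box_cart)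
    then show "compact {\<theta> :: real^'n. \<forall>i. 0 \<le> \<theta> $ i \<and> \<theta> $ i \<le> pi}" by simp
  qed
  have act_simps: "fst (act g z) = sign_change g (fst z)" "snd (act g z) $ i = snd z $ i + pi * of_int (g i)" for g z i
    by (simp_all add: act_def)
  interpret free_orbit_map ?G "?Q \<times> UNIV" ?K U2_cover act 1
  proof (rule free_orbit_map.intro)
    show "Group.group ?G" by simp
    show "free_orbit_map_axioms ?G (?Q \<times> UNIV) ?K U2_cover act 1"
    proof (rule free_orbit_map_axioms.intro)
      show "continuous_on (?Q \<times> UNIV) U2_cover"
        unfolding U2_cover_def mat_matrix_mult cis_conv_exp
        by (intro continuous_intros)
      show "compact ?K" by (rule compact_K)
      show "?K \<subseteq> ?Q \<times> UNIV" by auto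
      show "U2_cover ` ?K = U2_cover ` (?Q \<times> UNIV)" using im by simp
      show "continuous_on (?Q \<times> UNIV) (act g)" for g
        unfolding act_def by (intro continuous_intros)
      show "act g z \<in> ?Q \<times> UNIV" if "z \<in> ?Q \<times> UNIV" for g z
        using that by (auto simp: act_def sign_change_in)
      show "act \<one>\<^bsub>?G\<^esub> z = z" for z
        unfolding one by (simp add: act_def sign_change_def parity_sign_def vec_eq_iff prod_eq_iff)
      show "act (g \<otimes>\<^bsub>?G\<^esub> h) z = act g (act h z)" for g h z
        unfolding mult by (simp add: act_def sign_change_def parity_sign_add vec_eq_iff prod_eq_iff algebra_simps)
      show "U2_cover (act g z) = U2_cover z" for g z
      proof -
        have "mat (cis (s + pi * of_int k)) ** quaternion_matrix (parity_sign k *\<^sub>R x) = mat (cis s) ** quaternion_matrix x" for s k x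
          unfolding cis_mult[symmetric] cis_int_pi
          by (auto simp: mat_matrix_mult vec_eq_iff forall_2 complex_eq_iff parity_sign_def)
        then show ?thesis by (simp add: U2_cover_def act_simps sign_change_def)
      qed
      show "\<exists>g\<in>carrier ?G. w = act g z" if zw: "z \<in> ?Q \<times> UNIV" "w \<in> ?Q \<times> UNIV" "U2_cover z = U2_cover w" for z w
      proof -
        have "mat (cis (snd z $ i)) ** quaternion_matrix (fst z $ i) = mat (cis (snd w $ i)) ** quaternion_matrix (fst w $ i)" for i
          using zw(3) by (simp add: U2_cover_def vec_eq_iff[where 'b='n])
        then have "\<exists>k::int. snd w $ i = snd z $ i + pi * of_int k \<and> fst w $ i = parity_sign k *\<^sub>R fst z $ i" for i
          using zw by (intro U2_decomposition_unique) (auto simp: commuting_quaternions_def)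
        then obtain g :: "'n \<Rightarrow> int" where g: "\<And>i. snd w $ i = snd z $ i + pi * of_int (g i) \<and> fst w $ i = parity_sign (g i) *\<^sub>R fst z $ i"
          by metis
        then have "w = act g z" by (simp add: act_def sign_change_def prod_eq_iff vec_eq_iff)
        then show ?thesis unfolding carrier by blast
      qed
      show "1 \<le> dist (act g z) z" if ne: "g \<noteq> \<one>\<^bsub>?G\<^esub>" for g z
      proof -
        obtain i where "g i \<noteq> 0" using ne unfolding one by auto
        then have "1 * 1 \<le> pi * \<bar>of_int (g i)\<bar>" using pi_gt3 by (intro mult_mono) auto
        also have "\<dots> = dist (snd (act g z) $ i) (snd z $ i)"
          by (simp add: act_simps dist_real_def abs_mult)
        also have "\<dots> \<le> dist (snd (act g z)) (snd z)" by (rule dist_vec_nth_le)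
        also have "\<dots> \<le> dist (act g z) z" by (rule dist_snd_le)
        finally show ?thesis by simp
      qed
    qed simp
  qed
  define b :: "(quaternion^'n) \<times> (real^'n)" where "b = (\<chi> i. (1, 0), 0)"
  have "b \<in> ?Q \<times> UNIV" by (simp add: b_def commuting_quaternions_def norm_quaternion)
  moreover have "simply_connected (?Q \<times> (UNIV :: (real^'n) set))"
    by (intro simply_connected_Times simply_connected_commuting_quaternions convex_imp_simply_connected) simp
  moreover have "U2_cover b = one_tuple"
    by (simp add: U2_cover_def b_def one_tuple_def quaternion_matrix_one)
  ultimately show ?thesis
    using fundamental_group_orbit_map[of b] im by simp
qed

section \<open>Tuples in SO(3)\<close>

text \<open>
  The matrix of \<open>w \<mapsto> x w x*\<close> on imaginary quaternions, where \<open>x*\<close> is the conjugate of \<open>x\<close>.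
\<close>

definition rotation :: "quaternion \<Rightarrow> real^3^3"
  where "rotation x = (let a = fst x; b = snd x $ 1; c = snd x $ 2; d = snd x $ 3 in vector
    [vector [a * a + b * b - c * c - d * d, 2 * (b * c - a * d), 2 * (b * d + a * c)],
     vector [2 * (b * c + a * d), a * a - b * b + c * c - d * d, 2 * (c * d - a * b)],
     vector [2 * (b * d - a * c), 2 * (c * d + a * b), a * a - b * b - c * c + d * d]])"

lemma rotation_nth [simp]:
  "rotation x $ 1 $ 1 = fst x * fst x + snd x $ 1 * snd x $ 1 - snd x $ 2 * snd x $ 2 - snd x $ 3 * snd x $ 3"
  "rotation x $ 1 $ 2 = 2 * (snd x $ 1 * snd x $ 2 - fst x * snd x $ 3)"
  "rotation x $ 1 $ 3 = 2 * (snd x $ 1 * snd x $ 3 + fst x * snd x $ 2)"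
  "rotation x $ 2 $ 1 = 2 * (snd x $ 1 * snd x $ 2 + fst x * snd x $ 3)"
  "rotation x $ 2 $ 2 = fst x * fst x - snd x $ 1 * snd x $ 1 + snd x $ 2 * snd x $ 2 - snd x $ 3 * snd x $ 3"
  "rotation x $ 2 $ 3 = 2 * (snd x $ 2 * snd x $ 3 - fst x * snd x $ 1)"
  "rotation x $ 3 $ 1 = 2 * (snd x $ 1 * snd x $ 3 - fst x * snd x $ 2)"
  "rotation x $ 3 $ 2 = 2 * (snd x $ 2 * snd x $ 3 + fst x * snd x $ 1)"
  "rotation x $ 3 $ 3 = fst x * fst x - snd x $ 1 * snd x $ 1 - snd x $ 2 * snd x $ 2 + snd x $ 3 * snd x $ 3"
  by (simp_all add: rotation_def Let_def)

lemma rotation_mult: "rotation x ** rotation y = rotation (quaternion_mult x y)"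
  by (simp add: vec_eq_iff forall_3 matrix_matrix_mult_def sum_3 quaternion_mult_def
      cross_components inner_vec_def algebra_simps)

lemma rotation_one: "rotation (1, 0) = mat 1"
  by (simp add: vec_eq_iff forall_3 mat_def)

lemma rotation_uminus: "rotation (- x) = rotation x"
  by (simp add: vec_eq_iff forall_3)

lemma transpose_rotation: "transpose (rotation x) = rotation (fst x, - snd x)"
  by (simp add: vec_eq_iff forall_3 transpose_def)

lemma rotation_in_SO3:
  assumes "norm x = 1"
  shows "rotation x \<in> SO3"
proof -
  have "orthogonal_matrix (rotation x)"
    using quaternion_mult_conjugate[OF assms]
    by (simp add: orthogonal_matrix_def transpose_rotation rotation_mult rotation_one)
  moreover have "det (rotation x) = ((fst x)\<^sup>2 + (snd x $ 1)\<^sup>2 + (snd x $ 2)\<^sup>2 + (snd x $ 3)\<^sup>2) ^ 3"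
    by (simp add: det_3, algebra)
  ultimately show ?thesis
    using assms by (simp add: SO3_def rotation_matrix_def norm_quaternion_components)
qed

lemma trace_rotation: "norm x = 1 \<Longrightarrow> trace (rotation x) = 4 * (fst x)\<^sup>2 - 1"
  unfolding norm_quaternion_components
  by (simp add: trace_def sum_3 power2_eq_square)

lemma continuous_on_rotation [continuous_intros]:
  assumes f: "continuous_on S f"
  shows "continuous_on S (\<lambda>x. rotation (f x))"
proof (rule continuous_on_matrixI)
  fix i j :: 3
  have "\<forall>i j. continuous_on S (\<lambda>x. rotation (f x) $ i $ j)"
    unfolding forall_3 rotation_nth by (intro conjI continuous_intros f)
  then show "continuous_on S (\<lambda>x. rotation (f x) $ i $ j)" by blast
qed

lemma inner_quaternion:
  "(x :: quaternion) \<bullet> y = fst x * fst y + snd x $ 1 * snd y $ 1 + snd x $ 2 * snd y $ 2 + snd x $ 3 * snd y $ 3"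
  by (cases x; cases y) (simp add: inner_vec_def sum_3)

text \<open>
  The entries of the matrix and the norm determine all products of two components of the quaternion. Hence the
  square of \<open>x \<bullet> y\<close> equals the square of \<open>x \<bullet> x\<close>, and \<open>x \<bullet> y\<close> is \<open>1\<close> or \<open>-1\<close>.
\<close>

lemma rotation_eq_imp_eq_or_uminus:
  assumes "norm x = 1" "norm y = 1" "rotation x = rotation y"
  shows "y = x \<or> y = - x"
proof -
  obtain a b c d where x: "fst x = a" "snd x $ 1 = b" "snd x $ 2 = c" "snd x $ 3 = d" by blast
  obtain a' b' c' d' where y: "fst y = a'" "snd y $ 1 = b'" "snd y $ 2 = c'" "snd y $ 3 = d'" by blast
  have nx: "a * a + b * b + c * c + d * d = 1" and ny: "a' * a' + b' * b' + c' * c' + d' * d' = 1"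
    using assms(1,2) unfolding norm_quaternion_components x y by (simp_all add: power2_eq_square)
  have e: "a * a + b * b - c * c - d * d = a' * a' + b' * b' - c' * c' - d' * d'"
    "b * c - a * d = b' * c' - a' * d'" "b * d + a * c = b' * d' + a' * c'"
    "b * c + a * d = b' * c' + a' * d'" "a * a - b * b + c * c - d * d = a' * a' - b' * b' + c' * c' - d' * d'"
    "c * d - a * b = c' * d' - a' * b'" "b * d - a * c = b' * d' - a' * c'" "c * d + a * b = c' * d' + a' * b'"
    "a * a - b * b - c * c + d * d = a' * a' - b' * b' - c' * c' + d' * d'"
    using arg_cong[OF assms(3), of "\<lambda>M. M $ i $ j" for i j] rotation_nth[of x] rotation_nth[of y] unfolding x y
    by (metis mult_cancel_left zero_neq_numeral)+
  have p: "a' * a' = a * a" "b' * b' = b * b" "c' * c' = c * c" "d' * d' = d * d"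
    "a' * b' = a * b" "a' * c' = a * c" "a' * d' = a * d" "b' * c' = b * c" "b' * d' = b * d" "c' * d' = c * d"
    using e nx ny by linarith+
  have "(x \<bullet> y)\<^sup>2 = (a * a) * (a' * a') + (b * b) * (b' * b') + (c * c) * (c' * c') + (d * d) * (d' * d')
     + 2 * ((a * b) * (a' * b') + (a * c) * (a' * c') + (a * d) * (a' * d') + (b * c) * (b' * c') + (b * d) * (b' * d') + (c * d) * (c' * d'))"
    unfolding inner_quaternion x y by (simp add: power2_eq_square algebra_simps)
  also have "\<dots> = (a * a + b * b + c * c + d * d)\<^sup>2"
    unfolding p by (simp add: power2_eq_square algebra_simps)
  finally have "x \<bullet> y = 1 \<or> x \<bullet> y = -1" using nx by (simp add: power2_eq_1_iff)
  moreover have "(norm (y - x))\<^sup>2 = 2 - 2 * (x \<bullet> y)" "(norm (y + x))\<^sup>2 = 2 + 2 * (x \<bullet> y)"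
    using assms unfolding power2_norm_eq_inner norm_eq_1
    by (simp_all add: inner_diff_left inner_diff_right inner_add_left inner_add_right inner_commute)
  ultimately have "norm (y - x) = 0 \<or> norm (y + x) = 0" by auto
  then show ?thesis by (auto simp: eq_neg_iff_add_eq_0)
qed

text \<open>
  The half turn about the bisector of two unit vectors exchanges them. If the first column of \<open>A\<close> is opposite to
  the first basis vector there is no bisector, but any half turn about an orthogonal axis serves.
\<close>

lemma half_turn_with_first_column:
  fixes A :: "real^3^3"
  assumes "A \<in> SO3"
  shows "\<exists>h. norm h = 1 \<and> fst h = 0 \<and> (\<forall>i. rotation h $ i $ 1 = A $ i $ 1)"
proof -
  define f where "f i = A $ i $ 1" for i
  have "(transpose A ** A) $ 1 $ 1 = 1"
    using assms by (simp add: SO3_def rotation_matrix_def orthogonal_matrix_def mat_def)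
  then have f: "f 1 * f 1 + f 2 * f 2 + f 3 * f 3 = 1"
    by (simp add: matrix_matrix_mult_def transpose_def sum_3 f_def)
  show ?thesis
  proof (cases "f 1 = -1")
    case True
    then have "f 2 * f 2 + f 3 * f 3 = 0" using f by simp
    then have "f 2 = 0" "f 3 = 0" by (simp_all add: sum_squares_eq_zero_iff)
    moreover have "norm ((0, vector [0, 1, 0]) :: quaternion) = 1"
      unfolding norm_quaternion_components by simp
    ultimately show ?thesis using True
      by (intro exI[of _ "(0, vector [0, 1, 0])"]) (simp add: f_def forall_3)
  next
    case False
    have "f 1 * f 1 \<le> 1" using f zero_le_square[of "f 2"] zero_le_square[of "f 3"] by linarith
    then have "- 1 \<le> f 1" using abs_le_square_iff[of "f 1" 1] by (simp add: power2_eq_square)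
    then have pos: "0 < 1 + f 1" using False by linarith
    \<comment> \<open>The norm of the sum of the first basis vector and the first column.\<close>
    define n where "n = sqrt (2 * (1 + f 1))"
    have nn: "n * n = 2 * (1 + f 1)" "0 < n" using pos by (simp_all add: n_def)
    define h :: quaternion where "h = (0, vector [(1 + f 1) / n, f 2 / n, f 3 / n])"
    have "(1 + f 1) * (1 + f 1) + f 2 * f 2 + f 3 * f 3 = n * n"
      using f unfolding nn by (simp add: algebra_simps)
    then have "norm h = 1"
      using nn(2) unfolding norm_quaternion_components
      by (simp add: h_def power2_eq_square flip: add_divide_distrib)
    moreover have "(1 + f 1) * (1 + f 1) - f 2 * f 2 - f 3 * f 3 = n * n * f 1"
      using f unfolding nn by (simp add: algebra_simps)
    then have "rotation h $ 1 $ 1 = f 1"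
      using nn(2) by (simp add: h_def flip: diff_divide_distrib)
    moreover have "rotation h $ 2 $ 1 = f 2" "rotation h $ 3 $ 1 = f 3"
      using nonzero_mult_div_cancel_left[of "2 * (1 + f 1)"] pos
      by (simp_all add: h_def nn(1) flip: mult.assoc)
    ultimately show ?thesis by (intro exI[of _ h]) (simp add: f_def forall_3, simp add: h_def)
  qed
qed

text \<open>
  Such a matrix is a plane rotation on the orthogonal complement of the first basis vector, and a rotation by the
  angle \<open>t\<close> comes from a quaternion with the angle \<open>t / 2\<close>.
\<close>

lemma SO3_fixing_axis:
  assumes B: "B \<in> SO3" and fix1: "B $ 1 $ 1 = 1" "B $ 2 $ 1 = 0" "B $ 3 $ 1 = 0"
  shows "\<exists>x. norm x = 1 \<and> B = rotation x"
proof -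
  have o: "transpose B ** B = mat 1" "B ** transpose B = mat 1" and d: "det B = 1"
    using B by (auto simp: SO3_def rotation_matrix_def orthogonal_matrix_def)
  have "(B ** transpose B) $ 1 $ 1 = 1" unfolding o by (simp add: mat_def)
  then have "B $ 1 $ 2 * B $ 1 $ 2 + B $ 1 $ 3 * B $ 1 $ 3 = 0"
    by (simp add: matrix_matrix_mult_def transpose_def sum_3 fix1)
  then have r: "B $ 1 $ 2 = 0" "B $ 1 $ 3 = 0" by (simp_all add: sum_squares_eq_zero_iff)
  have "(transpose B ** B) $ 2 $ 2 = 1" "(transpose B ** B) $ 3 $ 3 = 1" unfolding o by (simp_all add: mat_def)
  then have c: "B $ 2 $ 2 * B $ 2 $ 2 + B $ 3 $ 2 * B $ 3 $ 2 = 1" "B $ 2 $ 3 * B $ 2 $ 3 + B $ 3 $ 3 * B $ 3 $ 3 = 1"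
    by (simp_all add: matrix_matrix_mult_def transpose_def sum_3 r)
  have dd: "B $ 2 $ 2 * B $ 3 $ 3 - B $ 2 $ 3 * B $ 3 $ 2 = 1"
    using d by (simp add: det_3 fix1 r)
  have "(B $ 2 $ 2 - B $ 3 $ 3)\<^sup>2 + (B $ 2 $ 3 + B $ 3 $ 2)\<^sup>2 = 0"
    using c dd by (simp add: power2_eq_square algebra_simps)
  then have s: "B $ 3 $ 3 = B $ 2 $ 2" "B $ 2 $ 3 = - B $ 3 $ 2"
    by (simp_all add: sum_power2_eq_zero_iff)
  obtain t where t: "B $ 2 $ 2 = cos t" "B $ 3 $ 2 = sin t"
    using sincos_total_2pi[of "B $ 2 $ 2" "B $ 3 $ 2"] c(1) by (metis power2_eq_square)
  define x :: quaternion where "x = (cos (t / 2), vector [sin (t / 2), 0, 0])"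
  have "cos t = cos (t / 2) * cos (t / 2) - sin (t / 2) * sin (t / 2)" "sin t = 2 * (cos (t / 2) * sin (t / 2))"
    using cos_double[of "t / 2"] sin_double[of "t / 2"] by (simp_all add: power2_eq_square)
  moreover have "cos (t / 2) * cos (t / 2) + sin (t / 2) * sin (t / 2) = 1"
    using sin_cos_squared_add2[of "t / 2"] by (simp add: power2_eq_square)
  ultimately have "B = rotation x"
    by (simp add: vec_eq_iff forall_3 x_def fix1 r s t)
  moreover have "norm x = 1" by (simp add: norm_quaternion_components x_def)
  ultimately show ?thesis by blast
qed

lemma SO3_mult: "A \<in> SO3 \<Longrightarrow> B \<in> SO3 \<Longrightarrow> A ** B \<in> SO3"
  by (simp add: SO3_def rotation_matrix_def orthogonal_matrix_mul det_mul)

text \<open>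
  Composing \<open>A\<close> with a half turn that has the same first column gives a matrix fixing the first basis vector.
\<close>

lemma rotation_surjective:
  assumes A: "A \<in> SO3"
  shows "\<exists>x. norm x = 1 \<and> A = rotation x"
proof -
  obtain h where h: "norm h = 1" "fst h = 0" and h1: "\<And>i. rotation h $ i $ 1 = A $ i $ 1"
    using half_turn_with_first_column[OF A] by blast
  have "(fst h, - snd h) = - h" using h by (simp add: prod_eq_iff)
  then have "transpose (rotation h) = rotation h" by (simp add: transpose_rotation rotation_uminus)
  then have hh: "rotation h ** rotation h = mat 1"
    using rotation_in_SO3[OF h(1)] by (metis SO3_def mem_Collect_eq orthogonal_matrix_def rotation_matrix_def)
  define B where "B = rotation h ** A"
  have "B $ i $ 1 = (rotation h ** rotation h) $ i $ 1" for i
    by (simp add: B_def matrix_matrix_mult_def h1)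
  then have "B $ i $ 1 = (if i = 1 then 1 else 0)" for i unfolding hh by (simp add: mat_def)
  then have "B $ 1 $ 1 = 1" "B $ 2 $ 1 = 0" "B $ 3 $ 1 = 0" by simp_all
  moreover have "B \<in> SO3" unfolding B_def by (intro SO3_mult rotation_in_SO3 h A)
  ultimately obtain x where x: "norm x = 1" "B = rotation x" using SO3_fixing_axis by blast
  have "A = rotation h ** B" unfolding B_def by (simp add: matrix_mul_assoc hh)
  then have "A = rotation (quaternion_mult h x)" using x by (simp add: rotation_mult)
  then show ?thesis using norm_quaternion_mult h x by blast
qed

definition SO3_cover :: "quaternion^'n \<Rightarrow> real^3^3^'n"
  where "SO3_cover x = (\<chi> i. rotation (x $ i))"

lemma continuous_on_SO3_cover: "continuous_on S SO3_cover"
  unfolding SO3_cover_def by (intro continuous_intros)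

text \<open>
  A rotation has trace \<open>-1\<close> iff it is a half turn. Two half turns whose product is a half turn have orthogonal axes
  and generate a Klein four-group; the commuting tuples with two such entries turn out to be those outside the identity
  component. Stated by traces, the condition is visibly closed.
\<close>

definition klein_tuples :: "(real^3^3^'n) set"
  where "klein_tuples = {A. \<exists>i j. trace (A $ i) = -1 \<and> trace (A $ j) = -1 \<and> trace (A $ i ** A $ j) = -1}"

lemma closed_klein_tuples: "closed (klein_tuples :: (real^3^3^'n) set)"
proof -
  have *: "klein_tuples = (\<Union>i. \<Union>j. {A :: real^3^3^'n. trace (A $ i) = -1 \<and> trace (A $ j) = -1 \<and> trace (A $ i ** A $ j) = -1})"
    by (auto simp: klein_tuples_def)
  show ?thesis
    unfolding * trace_def matrix_matrix_mult_def sum_3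
    by (intro closed_UN ballI closed_Collect_conj closed_Collect_eq) (auto intro!: continuous_intros)
qed

text \<open>
  The real part of the equation says \<open>fst x * fst y = snd x \<bullet> snd y\<close>. The cross product is already antisymmetric,
  so the rest of the imaginary part vanishes, and its inner product with \<open>snd y\<close> is \<open>fst x\<close> times the squared norm of \<open>y\<close>.
\<close>

lemma anticommuting_quaternions:
  assumes "norm y = 1" "quaternion_mult x y = - quaternion_mult y x"
  shows "fst x = 0 \<and> snd x \<bullet> snd y = 0"
proof -
  have 1: "fst x * fst y = snd x \<bullet> snd y"
    using assms(2) by (auto simp: quaternion_mult_def prod_eq_iff inner_commute)
  have "cross3 (snd y) (snd x) = - cross3 (snd x) (snd y)" by (rule cross_skew)
  then have "fst x *\<^sub>R snd y + fst y *\<^sub>R snd x =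
     - (fst x *\<^sub>R snd y + fst y *\<^sub>R snd x)"
    using assms(2) by (simp add: quaternion_mult_def prod_eq_iff add.commute)
  then have "2 *\<^sub>R (fst x *\<^sub>R snd y + fst y *\<^sub>R snd x) = 0"
    unfolding scaleR_2 by (metis add.right_inverse)
  then have "fst x *\<^sub>R snd y + fst y *\<^sub>R snd x = 0" by simp
  then have "(fst x *\<^sub>R snd y + fst y *\<^sub>R snd x) \<bullet> snd y = 0" by simp
  then have "fst x * (snd y \<bullet> snd y) + fst y * (fst x * fst y) = 0"
    by (simp add: inner_add_left 1)
  then have "fst x * ((fst y)\<^sup>2 + (norm (snd y))\<^sup>2) = 0"
    unfolding power2_norm_eq_inner by (simp add: power2_eq_square algebra_simps)
  then have "fst x = 0" using assms(1) unfolding norm_quaternion by simp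
  then show ?thesis using 1 by simp
qed

text \<open>
  Quaternions over two commuting rotations commute up to sign. If all signs are positive the tuple comes from
  commuting quaternions; a negative sign forces two half turns about orthogonal axes.
\<close>

lemma commuting_tuples_SO3_cases:
  "commuting_tuples SO3 \<subseteq> SO3_cover ` (commuting_quaternions :: (quaternion^'n) set) \<union> klein_tuples"
proof
  fix A :: "real^3^3^'n" assume A: "A \<in> commuting_tuples SO3"
  then have "\<exists>x. norm x = 1 \<and> A $ i = rotation x" for i
    by (intro rotation_surjective) (simp add: commuting_tuples_def)
  then obtain x where x: "\<And>i. norm (x i) = 1" "\<And>i. A $ i = rotation (x i)" by metis
  show "A \<in> SO3_cover ` commuting_quaternions \<union> klein_tuples"
  proof (cases "\<forall>i j. quaternion_mult (x i) (x j) = quaternion_mult (x j) (x i)")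
    case True
    then have "(\<chi> i. x i) \<in> commuting_quaternions"
      using x by (simp add: commuting_quaternions_def quaternion_mult_commute_iff)
    moreover have "A = SO3_cover (\<chi> i. x i)" using x by (simp add: SO3_cover_def vec_eq_iff)
    ultimately show ?thesis by blast
  next
    case False
    then obtain i j where ij: "quaternion_mult (x i) (x j) \<noteq> quaternion_mult (x j) (x i)" by blast
    have "A $ i ** A $ j = A $ j ** A $ i" using A by (simp add: commuting_tuples_def)
    then have "rotation (quaternion_mult (x j) (x i)) = rotation (quaternion_mult (x i) (x j))"
      by (simp add: x(2) rotation_mult)
    then have anti: "quaternion_mult (x i) (x j) = - quaternion_mult (x j) (x i)"
      using rotation_eq_imp_eq_or_uminus ij norm_quaternion_mult x(1) by metis
    then have anti': "quaternion_mult (x j) (x i) = - quaternion_mult (x i) (x j)" by simp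
    have "fst (x i) = 0" "snd (x i) \<bullet> snd (x j) = 0" "fst (x j) = 0"
      using anticommuting_quaternions[OF x(1) anti] anticommuting_quaternions[OF x(1) anti'] by auto
    then have "fst (x i) = 0" "fst (x j) = 0" "fst (quaternion_mult (x i) (x j)) = 0"
      by (simp_all add: quaternion_mult_def)
    then have "trace (A $ i) = -1" "trace (A $ j) = -1" "trace (A $ i ** A $ j) = -1"
      using x(1) by (simp_all add: x(2) rotation_mult trace_rotation norm_quaternion_mult)
    then show ?thesis by (auto simp: klein_tuples_def)
  qed
qed

text \<open>
  Half turns come from imaginary unit quaternions, and if a product of two of them is imaginary, their imaginary
  parts are orthogonal. In a commuting tuple the imaginary parts are parallel.
\<close>

lemma SO3_cover_not_klein:
  assumes "x \<in> commuting_quaternions"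
  shows "SO3_cover x \<notin> klein_tuples"
proof
  assume "SO3_cover x \<in> klein_tuples"
  then obtain i j where ij: "trace (rotation (x $ i)) = -1" "trace (rotation (x $ j)) = -1"
    "trace (rotation (quaternion_mult (x $ i) (x $ j))) = -1"
    by (auto simp: klein_tuples_def SO3_cover_def rotation_mult)
  have n: "norm (x $ i) = 1" "norm (x $ j) = 1" and cr: "cross3 (snd (x $ i)) (snd (x $ j)) = 0"
    using assms by (auto simp: commuting_quaternions_def)
  have z: "fst (x $ i) = 0" "fst (x $ j) = 0" "fst (quaternion_mult (x $ i) (x $ j)) = 0"
    using ij n by (simp_all add: trace_rotation norm_quaternion_mult)
  then have "norm (snd (x $ i)) = 1" "norm (snd (x $ j)) = 1"
    using n by (simp_all add: norm_prod_def)
  then show False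
    using norm_cross_dot[of "snd (x $ i)" "snd (x $ j)"] cr z by (simp add: quaternion_mult_def)
qed

text \<open>
  The image of the commuting quaternion tuples is connected and contains the identity tuple. Together with the
  closed set \<open>klein_tuples\<close>, which it does not meet, this closed image covers all commuting tuples; so a connected set
  of commuting tuples that contains the identity tuple cannot leave it.
\<close>

lemma commuting_tuples_SO3_plus_eq:
  "commuting_tuples_SO3_plus = SO3_cover ` (commuting_quaternions :: (quaternion^'n) set)"
proof
  let ?Q = "commuting_quaternions :: (quaternion^'n) set"
  let ?one = "\<chi> i. (1, 0) :: quaternion^'n"
  have one: "?one \<in> ?Q" "SO3_cover ?one = one_tuple"
    by (simp_all add: commuting_quaternions_def norm_quaternion SO3_cover_def one_tuple_def rotation_one)
  show "SO3_cover ` ?Q \<subseteq> commuting_tuples_SO3_plus"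
    unfolding commuting_tuples_SO3_plus_def
  proof (rule connected_component_maximal)
    show "one_tuple \<in> SO3_cover ` ?Q" using one by (metis imageI)
    show "connected (SO3_cover ` ?Q)"
      by (intro connected_continuous_image continuous_on_SO3_cover path_connected_imp_connected
          path_connected_commuting_quaternions)
    show "SO3_cover ` ?Q \<subseteq> commuting_tuples SO3"
    proof clarify
      fix x :: "quaternion^'n" assume x: "x \<in> ?Q"
      then have "quaternion_mult (x $ i) (x $ j) = quaternion_mult (x $ j) (x $ i)" for i j
        by (simp add: quaternion_mult_commute_iff commuting_quaternions_def)
      then show "SO3_cover x \<in> commuting_tuples SO3"
        using x by (simp add: commuting_tuples_def SO3_cover_def rotation_mult rotation_in_SO3 commuting_quaternions_def)
    qed
  qed
  show "commuting_tuples_SO3_plus \<subseteq> SO3_cover ` ?Q"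
  proof (rule ccontr)
    let ?Y = "commuting_tuples_SO3_plus :: (real^3^3^'n) set"
    assume "\<not> ?Y \<subseteq> SO3_cover ` ?Q"
    moreover have sub: "?Y \<subseteq> SO3_cover ` ?Q \<union> klein_tuples"
      using commuting_tuples_SO3_cases connected_component_subset unfolding commuting_tuples_SO3_plus_def by blast
    ultimately have "klein_tuples \<inter> ?Y \<noteq> {}" by blast
    moreover have "one_tuple \<in> SO3_cover ` ?Q \<inter> ?Y" using one one_tuple_in_SO3_plus by (metis IntI imageI)
    moreover have "SO3_cover ` ?Q \<inter> klein_tuples \<inter> ?Y = {}" using SO3_cover_not_klein by blast
    moreover have "closed (SO3_cover ` ?Q)"
      by (intro compact_imp_closed compact_continuous_image continuous_on_SO3_cover compact_commuting_quaternions)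
    moreover have "connected ?Y" by (simp add: commuting_tuples_SO3_plus_def)
    ultimately show False
      using sub closed_klein_tuples unfolding connected_closed by blast
  qed
qed

text \<open>
  The fibre of \<open>SO3_cover\<close> consists of the tuples obtained by changing the signs of entries, and a sign change
  moves an entry of norm one by two.
\<close>

lemma fundamental_group_commuting_tuples_SO3_plus:
  "fundamental_group (commuting_tuples_SO3_plus :: (real^3^3^'n) set) one_tuple
    \<cong> product_group (UNIV :: 'n set) (\<lambda>_. integer_mod_group 2)"
proof -
  let ?G = "product_group (UNIV :: 'n set) (\<lambda>_. integer_mod_group 2)"
  let ?Q = "commuting_quaternions :: (quaternion^'n) set"
  have carrier: "carrier ?G = {g. \<forall>i. g i = 0 \<or> g i = 1}"
  proof -
    have "k \<in> {0..<2} \<longleftrightarrow> k = 0 \<or> k = 1" for k :: int by auto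
    then show ?thesis
      by (simp add: PiE_UNIV_domain carrier_integer_mod_group Pi_iff set_eq_iff del: atLeastLessThan_iff)
  qed
  have one: "\<one>\<^bsub>?G\<^esub> = (\<lambda>_. 0)"
    and mult: "g \<otimes>\<^bsub>?G\<^esub> h = (\<lambda>i. (g i + h i) mod 2)" for g h
    by (simp_all add: restrict_def)
  interpret free_orbit_map ?G ?Q ?Q SO3_cover sign_change 1
  proof (rule free_orbit_map.intro)
    show "Group.group ?G" by simp
    show "free_orbit_map_axioms ?G ?Q ?Q SO3_cover sign_change 1"
    proof (rule free_orbit_map_axioms.intro)
      show "continuous_on ?Q SO3_cover" by (rule continuous_on_SO3_cover)
      show "compact ?Q" by (rule compact_commuting_quaternions)
      show "continuous_on ?Q (sign_change g)" for g by (intro continuous_intros)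
      show "sign_change g x \<in> ?Q" if "x \<in> ?Q" for g x using that by (rule sign_change_in)
      show "sign_change \<one>\<^bsub>?G\<^esub> x = x" for x :: "quaternion^'n"
        unfolding one by (simp add: sign_change_def parity_sign_def vec_eq_iff)
      show "sign_change (g \<otimes>\<^bsub>?G\<^esub> h) x = sign_change g (sign_change h x)" for g h and x :: "quaternion^'n"
        unfolding mult by (simp add: sign_change_def parity_sign_def vec_eq_iff)
      show "SO3_cover (sign_change g x) = SO3_cover x" for g and x :: "quaternion^'n"
        by (simp add: SO3_cover_def sign_change_def parity_sign_def rotation_uminus vec_eq_iff[where 'b='n])
      show "\<exists>g\<in>carrier ?G. y = sign_change g x" if xy: "x \<in> ?Q" "y \<in> ?Q" "SO3_cover x = SO3_cover y" for x y
      proof -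
        have "rotation (x $ i) = rotation (y $ i)" for i
          using xy(3) by (simp add: SO3_cover_def vec_eq_iff[where 'b='n])
        then have "y $ i = x $ i \<or> y $ i = - x $ i" for i
          using xy by (intro rotation_eq_imp_eq_or_uminus) (auto simp: commuting_quaternions_def)
        then have "y = sign_change (\<lambda>i. if y $ i = x $ i then 0 else 1) x"
          by (auto simp: sign_change_def parity_sign_def vec_eq_iff[where 'b='n])
        moreover have "(\<lambda>i. if y $ i = x $ i then 0 else 1) \<in> carrier ?G" unfolding carrier by simp
        ultimately show ?thesis by blast
      qed
      show "1 \<le> dist (sign_change g x) x" if g: "g \<in> carrier ?G" "g \<noteq> \<one>\<^bsub>?G\<^esub>" and x: "x \<in> ?Q" for g x
      proof -
        obtain i where "g i \<noteq> 0" using g(2) unfolding one by auto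
        then have "g i = 1" using g(1) unfolding carrier by blast
        then have "odd (g i)" by simp
        then show ?thesis using dist_sign_change[OF x, of g i] by linarith
      qed
    qed simp_all
  qed
  define b :: "quaternion^'n" where "b = (\<chi> i. (1, 0))"
  have "b \<in> ?Q" by (simp add: b_def commuting_quaternions_def norm_quaternion)
  moreover have "SO3_cover b = one_tuple"
    by (simp add: SO3_cover_def b_def one_tuple_def rotation_one)
  ultimately show ?thesis
    using fundamental_group_orbit_map[of b] simply_connected_commuting_quaternions
    by (simp add: commuting_tuples_SO3_plus_eq)
qed

section \<open>The three fundamental groups\<close>

theorem theorem1p2:
  shows "fundamental_group (commuting_tuples_SO3_plus :: (real^3^3^'n) set) one_tuple
           \<cong> product_group (UNIV :: 'n set) (\<lambda>_. integer_mod_group 2)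
       \<and> fundamental_group (commuting_tuples SU2 :: (complex^2^2^'n) set) one_tuple
           \<cong> singleton_group (0::int)
       \<and> fundamental_group (commuting_tuples U2 :: (complex^2^2^'n) set) one_tuple
           \<cong> product_group (UNIV :: 'n set) (\<lambda>_. integer_group)"
  by (intro conjI fundamental_group_commuting_tuples_SO3_plus fundamental_group_commuting_tuples_U2
      fundamental_group_simply_connected simply_connected_commuting_tuples_SU2 one_tuple_in_SU2)

end
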